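(* Let $\mathcal{A}=\{H_1,\dots,H_n\}$ be a central hyperplane arrangement in $\mathbb{Q}^l$, with $H_i=\alpha_i^{-1}(0)$, where the linear forms $\alpha_i\in\mathbb{Z}[x_1,\dots,x_l]$ are chosen so that no prime number divides any $\alpha_i$. If $\mathcal{A}$ is free in $\mathbb{Q}^l$ with exponents $(e_1,\dots,e_l)$, then, for all prime numbers $p$ that are good for $\mathcal{A}$ except possibly a finite number of them, the arrangement $\mathcal{A}_p$ is free in $\mathbb{F}_p^l$ with exponents $(e_1,\dots,e_l)$.
   Context: Let $K$ be a field and $S=K[x_1,\dots,x_l]$. A central hyperplane arrangement $\mathcal{B}$ in $K^l$ is a finite set of (distinct) hyperplanes through the origin, each given as $H=\beta_H^{-1}(0)$ with $\beta_H\in S$ a nonzero linear form. Let $\mathrm{Der}_{K^l}=\{\sum_{i=1}^l f_i\partial_{x_i}\mid f_i\in S\}$. A derivation $\delta=\sum_i f_i\partial_{x_i}$ is homogeneous of polynomial degree $d$, written $\mathrm{pdeg}(\delta)=d$, if all $f_i$ are homogeneous of degree $d$. The module of logarithmic vector fields is $D(\mathcal{B})=\{\delta\in\mathrm{Der}_{K^l}\mid \delta(\beta_H)\in(\beta_H)S \text{ for all } H\in\mathcal{B}\}$. The arrangement $\mathcal{B}$ is free with exponents $(e_1,\dots,e_l)$ if $D(\mathcal{B})$ is a free $S$-module having a basis $\delta_1,\dots,\delta_l$ of homogeneous derivations with $\mathrm{pdeg}(\delta_i)=e_i$ (exponents are considered up to order). For the arrangement $\mathcal{A}$ in $\mathbb{Q}^l$: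 after clearing denominators and common factors, each $H_i$ is given by a linear form $\alpha_i$ with integer coefficients such that no prime divides $\alpha_i$; put $Q(\mathcal{A})=\prod_{i=1}^n\alpha_i\in\mathbb{Z}[x_1,\dots,x_l]$. For a prime $p$ let $\pi_p\colon\mathbb{Z}[x_1,\dots,x_l]\to\mathbb{F}_p[x_1,\dots,x_l]$ be the canonical homomorphism (reduction modulo $p$). The prime $p$ is good for $\mathcal{A}$ if $\pi_p(Q(\mathcal{A}))$ is reduced (square-free). For a good prime $p$, $\mathcal{A}_p$ is the central arrangement in $\mathbb{F}_p^l$ defined by $\pi_p(Q(\mathcal{A}))$, i.e. consisting of the hyperplanes $\pi_p(\alpha_i)=0$, $i=1,\dots,n$. *)

theory Defs
  imports
    "HOL-Algebra.Algebraic_Closure_Type"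
    "HOL-Algebra.IntRing"
    "HOL-Number_Theory.Residues"
    "Jordan_Normal_Form.Missing_VectorSpace"
begin

section \<open>Polynomials over a ring with carrier\<close>

text \<open>
  The coefficient ring is a ring record rather than a type of class \<open>field\<close>, because the prime
  \<open>p\<close> of \<open>\<F>\<^sub>p\<close> is quantified inside the theorem. The polynomials are those of
  \<^theory>\<open>HOL-Algebra.Indexed_Polynomials\<close>: a monomial is a multiset of variables and a polynomial
  maps monomials to coefficients. That theory supplies the carrier and the addition; only
  multiplication by a variable is available there, so the Cauchy product is added here. The
  variables \<open>x\<^sub>1, \<dots>, x\<^sub>l\<close> are numbered \<open>0, \<dots>, l - 1\<close>.
\<close>

definition mpoly_mult ::
    "('a, 'r) ring_scheme \<Rightarrow> (nat multiset \<Rightarrow> 'a) \<Rightarrow> (nat multiset \<Rightarrow> 'a) \<Rightarrow> nat multiset \<Rightarrow> 'a" where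
  "mpoly_mult R f g = (\<lambda>m. \<Oplus>\<^bsub>R\<^esub>a\<in>{a. a \<subseteq># m}. f a \<otimes>\<^bsub>R\<^esub> g (m - a))"

definition mpoly_ring :: "('a, 'r) ring_scheme \<Rightarrow> nat \<Rightarrow> (nat multiset \<Rightarrow> 'a) ring" where
  "mpoly_ring R l =
    \<lparr>carrier = ring.indexed_pset R {..<l} (carrier R),
     monoid.mult = mpoly_mult R,
     one = ring.indexed_const R \<one>\<^bsub>R\<^esub>,
     zero = ring.indexed_const R \<zero>\<^bsub>R\<^esub>,
     add = ring.indexed_padd R\<rparr>"

definition homogeneous :: "('a, 'r) ring_scheme \<Rightarrow> nat \<Rightarrow> (nat multiset \<Rightarrow> 'a) \<Rightarrow> bool" where
  "homogeneous R d f \<longleftrightarrow> (\<forall>m. f m \<noteq> \<zero>\<^bsub>R\<^esub> \<longrightarrow> size m = d)"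

definition linear_form :: "('a, 'r) ring_scheme \<Rightarrow> nat \<Rightarrow> (nat multiset \<Rightarrow> 'a) \<Rightarrow> bool" where
  "linear_form R l \<beta> \<longleftrightarrow>
    \<beta> \<in> carrier (mpoly_ring R l) \<and> homogeneous R 1 \<beta> \<and> \<beta> \<noteq> \<zero>\<^bsub>mpoly_ring R l\<^esub>"

definition mpoly_eval ::
    "('a, 'r) ring_scheme \<Rightarrow> nat \<Rightarrow> (nat multiset \<Rightarrow> 'a) \<Rightarrow> (nat \<Rightarrow> 'a) \<Rightarrow> 'a" where
  "mpoly_eval R l f v =
    (\<Oplus>\<^bsub>R\<^esub>m\<in>{m. f m \<noteq> \<zero>\<^bsub>R\<^esub>}. f m \<otimes>\<^bsub>R\<^esub> (\<Otimes>\<^bsub>R\<^esub>i\<in>{..<l}. v i [^]\<^bsub>R\<^esub> count m i))"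

text \<open>
  The coefficient of \<open>m\<close> in \<open>\<partial>f/\<partial>x\<^sub>i\<close> comes from that of \<open>x\<^sub>i m\<close> in \<open>f\<close>, in which \<open>x\<^sub>i\<close> has
  exponent \<open>count m i + 1\<close>.
\<close>

definition mpoly_deriv ::
    "('a, 'r) ring_scheme \<Rightarrow> nat \<Rightarrow> (nat multiset \<Rightarrow> 'a) \<Rightarrow> nat multiset \<Rightarrow> 'a" where
  "mpoly_deriv R i f = (\<lambda>m. [Suc (count m i)] \<cdot>\<^bsub>R\<^esub> f (add_mset i m))"

definition square_free :: "('b, 's) ring_scheme \<Rightarrow> 'b \<Rightarrow> bool" where
  "square_free S f \<longleftrightarrow> (\<forall>g\<in>carrier S. (g \<otimes>\<^bsub>S\<^esub> g) divides\<^bsub>S\<^esub> f \<longrightarrow> g \<in> Units S)"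


section \<open>Central arrangements and their logarithmic vector fields\<close>

definition zero_locus ::
    "('a, 'r) ring_scheme \<Rightarrow> nat \<Rightarrow> (nat multiset \<Rightarrow> 'a) \<Rightarrow> (nat \<Rightarrow> 'a) set" where
  "zero_locus K l \<beta> = {v \<in> {..<l} \<rightarrow>\<^sub>E carrier K. mpoly_eval K l \<beta> v = \<zero>\<^bsub>K\<^esub>}"

definition central_arrangement ::
    "('a, 'r) ring_scheme \<Rightarrow> nat \<Rightarrow> (nat \<Rightarrow> 'a) set set \<Rightarrow> bool" where
  "central_arrangement K l B \<longleftrightarrow>
    finite B \<and> (\<forall>H\<in>B. \<exists>\<beta>. linear_form K l \<beta> \<and> H = zero_locus K l \<beta>)"

text \<open>The derivation \<open>\<Sum>\<^sub>i f\<^sub>i \<partial>/\<partial>x\<^sub>i\<close> is represented by the family \<open>f\<close> of its coefficients.\<close>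

definition Der ::
    "('a, 'r) ring_scheme \<Rightarrow> nat \<Rightarrow> (nat multiset \<Rightarrow> 'a, nat \<Rightarrow> nat multiset \<Rightarrow> 'a) module" where
  "Der K l = ring.func_space (mpoly_ring K l) {..<l}"

definition der_apply ::
    "('a, 'r) ring_scheme \<Rightarrow> nat \<Rightarrow> (nat \<Rightarrow> nat multiset \<Rightarrow> 'a) \<Rightarrow>
      (nat multiset \<Rightarrow> 'a) \<Rightarrow> nat multiset \<Rightarrow> 'a" where
  "der_apply K l \<delta> g =
    (\<Oplus>\<^bsub>mpoly_ring K l\<^esub>i\<in>{..<l}. \<delta> i \<otimes>\<^bsub>mpoly_ring K l\<^esub> mpoly_deriv K i g)"

definition has_pdeg ::
    "('a, 'r) ring_scheme \<Rightarrow> nat \<Rightarrow> (nat \<Rightarrow> nat multiset \<Rightarrow> 'a) \<Rightarrow> nat \<Rightarrow> bool" where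
  "has_pdeg K l \<delta> d \<longleftrightarrow> (\<forall>i<l. homogeneous K d (\<delta> i))"

text \<open>
  An arrangement is a set of hyperplanes without chosen equations. Since the equation of a
  hyperplane is unique up to a nonzero scalar, asking the condition of every equation \<open>\<beta>\<close> of \<open>H\<close>
  is the same as asking it of one chosen \<open>\<beta>\<^sub>H\<close>.
\<close>

definition log_der ::
    "('a, 'r) ring_scheme \<Rightarrow> nat \<Rightarrow> (nat \<Rightarrow> 'a) set set \<Rightarrow>
      (nat multiset \<Rightarrow> 'a, nat \<Rightarrow> nat multiset \<Rightarrow> 'a) module" where
  "log_der K l B = (Der K l)
    \<lparr>carrier := {\<delta> \<in> carrier (Der K l).
      \<forall>H\<in>B. \<forall>\<beta>. linear_form K l \<beta> \<and> H = zero_locus K l \<beta> \<longrightarrow>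
        der_apply K l \<delta> \<beta> \<in> PIdl\<^bsub>mpoly_ring K l\<^esub> \<beta>}\<rparr>"

definition indexed_basis ::
    "('b, 's) ring_scheme \<Rightarrow> ('b, 'c, 't) module_scheme \<Rightarrow> 'i set \<Rightarrow> ('i \<Rightarrow> 'c) \<Rightarrow> bool" where
  "indexed_basis S M I \<delta> \<longleftrightarrow>
    \<delta> ` I \<subseteq> carrier M \<and> inj_on \<delta> I \<and>
    \<not> LinearCombinations.module.lin_dep S M (\<delta> ` I) \<and>
    LinearCombinations.module.span S M (\<delta> ` I) = carrier M"

text \<open>
  Only the values \<open>e 0, \<dots>, e (l - 1)\<close> matter, and only up to order, because a basis may be
  reindexed.
\<close>

definition free_with_exponents ::
    "('a, 'r) ring_scheme \<Rightarrow> nat \<Rightarrow> (nat \<Rightarrow> 'a) set set \<Rightarrow> (nat \<Rightarrow> nat) \<Rightarrow> bool" where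
  "free_with_exponents K l B e \<longleftrightarrow>
    (\<exists>\<delta>. indexed_basis (mpoly_ring K l) (log_der K l B) {..<l} \<delta> \<and>
      (\<forall>i<l. has_pdeg K l (\<delta> i) (e i)))"


section \<open>Reduction modulo a prime\<close>

abbreviation rat_field :: "rat ring" where
  "rat_field \<equiv> ring_of_type_algebra"

abbreviation prime_field :: "nat \<Rightarrow> int ring" where
  "prime_field p \<equiv> residue_ring (int p)"

definition int_to_rat :: "(nat multiset \<Rightarrow> int) \<Rightarrow> nat multiset \<Rightarrow> rat" where
  "int_to_rat f = (\<lambda>m. of_int (f m))"

definition reduce_mod :: "nat \<Rightarrow> (nat multiset \<Rightarrow> int) \<Rightarrow> nat multiset \<Rightarrow> int" where
  "reduce_mod p f = (\<lambda>m. f m mod int p)"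

definition primitive :: "nat \<Rightarrow> (nat multiset \<Rightarrow> int) \<Rightarrow> bool" where
  "primitive l f \<longleftrightarrow>
    (\<forall>q::nat. Factorial_Ring.prime q \<longrightarrow>
      \<not> (ring.indexed_const \<Z> (int q)) divides\<^bsub>mpoly_ring \<Z> l\<^esub> f)"

definition defining_poly ::
    "nat \<Rightarrow> nat \<Rightarrow> (nat \<Rightarrow> nat multiset \<Rightarrow> int) \<Rightarrow> nat multiset \<Rightarrow> int" where
  "defining_poly l n \<alpha> = (\<Otimes>\<^bsub>mpoly_ring \<Z> l\<^esub>i\<in>{..<n}. \<alpha> i)"

definition good_prime :: "nat \<Rightarrow> nat \<Rightarrow> (nat \<Rightarrow> nat multiset \<Rightarrow> int) \<Rightarrow> nat \<Rightarrow> bool" where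
  "good_prime l n \<alpha> p \<longleftrightarrow> Factorial_Ring.prime p \<and>
    square_free (mpoly_ring (prime_field p) l) (reduce_mod p (defining_poly l n \<alpha>))"

definition reduced_arrangement ::
    "nat \<Rightarrow> nat \<Rightarrow> (nat \<Rightarrow> nat multiset \<Rightarrow> int) \<Rightarrow> nat \<Rightarrow> (nat \<Rightarrow> int) set set" where
  "reduced_arrangement l n \<alpha> p =
    (\<lambda>i. zero_locus (prime_field p) l (reduce_mod p (\<alpha> i))) ` {..<n}"

end

(*
  A family of l logarithmic derivations has a coefficient determinant divisible by the defining
  polynomial Q, and it is a basis of the module of logarithmic derivations if and only if the
  determinant is a unit times Q (Saito's criterion). Clearing denominators turns the data of a basis
  over the rationals, namely its coefficients, the quotients delta(alpha) / alpha, the unit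
  det / Q and its inverse, into integer polynomials satisfying the same identities up to integer
  factors. For every prime dividing none of these integers the identities survive reduction, and
  Saito's criterion over the prime field gives a basis with the same degrees.
*)
theory Submission
  imports Defs "HOL-Library.Poly_Mapping" "HOL-Library.Multiset_Order" "Jordan_Normal_Form.Determinant"
begin

text \<open>Determinants belong to types of class \<open>comm_ring_1\<close>, while the polynomial
  rings here are records whose coefficient ring varies with \<open>p\<close>. Hence every polynomial
  is handled through a preimage in a type, and identities are stated after applying a homomorphism.
  The same integer preimage has an image over \<open>\<Z>\<close> and over each prime field, so
  passing to residues means changing the map and keeping the matrix.

  Both directions of the criterion are needed: over the rationals a basis must yield the unit, over
  the prime field the unit must yield a basis. The first direction is the harder one. It is reached
  from the primality of linear forms alone, together with explicit logarithmic derivations that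
  bound how often a form can occur in the determinant.

  Goodness of \<open>p\<close> keeps distinct forms non-proportional after reduction, since two
  proportional ones would put the square of a linear form into the reduced \<open>Q\<close>. A form
  must also stay nonzero, so one nonzero coefficient of each form joins the integers that
  \<open>p\<close> must not divide.\<close>

section \<open>Adjugate identities and Cramer's rule\<close>

lemma adj_mat_mult_sum:
  fixes M :: "'b::comm_ring_1 mat"
  assumes "M \<in> carrier_mat l l" "i < l" "j < l"
  shows "(\<Sum>k<l. adj_mat M $$ (i,k) * M $$ (k,j)) = (if i = j then det M else 0)"
    and "(\<Sum>k<l. M $$ (i,k) * adj_mat M $$ (k,j)) = (if i = j then det M else 0)"
proof -
  note adj = adj_mat[OF assms(1)]
  have "(adj_mat M * M) $$ (i,j) = (\<Sum>k<l. adj_mat M $$ (i,k) * M $$ (k,j))"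
    "(M * adj_mat M) $$ (i,j) = (\<Sum>k<l. M $$ (i,k) * adj_mat M $$ (k,j))"
    using assms adj(1)[THEN carrier_matD(1)] adj(1)[THEN carrier_matD(2)]
    by (auto simp: scalar_prod_def atLeast0LessThan)
  then show "(\<Sum>k<l. adj_mat M $$ (i,k) * M $$ (k,j)) = (if i = j then det M else 0)"
    and "(\<Sum>k<l. M $$ (i,k) * adj_mat M $$ (k,j)) = (if i = j then det M else 0)"
    using adj(2,3) assms by auto
qed

text \<open>Cofactors along row \<open>i\<close> do not involve that row, so they are still those of
  \<open>M\<close>. The value is the Cramer numerator for the coordinate of \<open>\<eta>\<close>
  along row \<open>i\<close>.\<close>

lemma det_replace_row:
  fixes M :: "'b::comm_ring_1 mat"
  assumes "M \<in> carrier_mat l l" "i < l"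
  shows "det (mat l l (\<lambda>(r,j). if r = i then \<eta> j else M $$ (r,j))) = (\<Sum>j<l. \<eta> j * adj_mat M $$ (j,i))"
    (is "det ?N = _")
proof -
  have "det ?N = (\<Sum>j<l. ?N $$ (i,j) * cofactor ?N i j)"
    by (rule laplace_expansion_row) (use assms in auto)
  also have "\<dots> = (\<Sum>j<l. \<eta> j * adj_mat M $$ (j,i))"
  proof (rule sum.cong)
    fix j assume j: "j \<in> {..<l}"
    have "mat_delete ?N i j = mat_delete M i j"
      using assms j by (auto simp: mat_delete_def intro!: eq_matI)
    then show "?N $$ (i,j) * cofactor ?N i j = \<eta> j * adj_mat M $$ (j,i)"
      using assms j by (auto simp: adj_mat_def cofactor_def)
  qed simp
  finally show ?thesis .
qed

section \<open>Saito's criterion\<close>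

locale domain_hom = domain S for S :: "('a, 'm) ring_scheme" (structure) +
  fixes H :: "'r::comm_ring_1 \<Rightarrow> 'a"
  assumes H_closed [simp]: "H x \<in> carrier S"
    and H_add: "H (x + y) = H x \<oplus> H y"
    and H_mult: "H (x * y) = H x \<otimes> H y"
    and H_one: "H 1 = \<one>"
begin

lemma H_zero: "H 0 = \<zero>"
  using H_add[of 0 0] by (simp add: add.r_cancel_one')

lemma H_sum_cong: "(\<And>i. i \<in> A \<Longrightarrow> H (f i) = H (g i)) \<Longrightarrow> H (sum f A) = H (sum g A)"
  by (induction A rule: infinite_finite_induct) (auto simp: H_add)

lemma H_prod_cong: "(\<And>i. i \<in> A \<Longrightarrow> H (f i) = H (g i)) \<Longrightarrow> H (prod f A) = H (prod g A)"
  by (induction A rule: infinite_finite_induct) (auto simp: H_mult)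

text \<open>The Leibniz formula uses only sums and products of entries. This allows matrices to be
  compared whose entries agree only after \<open>H\<close>.\<close>

lemma H_det_cong:
  assumes "M \<in> carrier_mat l l" "N \<in> carrier_mat l l"
    and "\<And>i j. i < l \<Longrightarrow> j < l \<Longrightarrow> H (M $$ (i,j)) = H (N $$ (i,j))"
  shows "H (det M) = H (det N)"
  unfolding det_def'[OF assms(1)] det_def'[OF assms(2)]
proof (rule H_sum_cong)
  fix p assume "p \<in> {p. p permutes {0..<l}}"
  then have "H (\<Prod>i=0..<l. M $$ (i, p i)) = H (\<Prod>i=0..<l. N $$ (i, p i))"
    by (intro H_prod_cong assms(3)) (auto dest: permutes_in_image)
  then show "H (signof p * (\<Prod>i=0..<l. M $$ (i, p i))) = H (signof p * (\<Prod>i=0..<l. N $$ (i, p i)))"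
    by (simp add: H_mult)
qed

lemma H_cancel:
  assumes "H (x * y) = H (x * z)" "H x \<noteq> \<zero>"
  shows "H y = H z"
  using assms by (simp add: H_mult m_lcancel)

lemma H_prod_nonzero: "(\<And>i. i \<in> A \<Longrightarrow> H (f i) \<noteq> \<zero>) \<Longrightarrow> H (prod f A) \<noteq> \<zero>"
  by (induction A rule: infinite_finite_induct) (auto simp: H_mult H_one integral_iff)

lemma H_sum: "finite A \<Longrightarrow> H (sum f A) = (\<Oplus>i\<in>A. H (f i))"
  by (induction A rule: finite_induct) (auto simp: H_zero H_add)

lemma H_prod: "finite A \<Longrightarrow> H (prod f A) = (\<Otimes>i\<in>A. H (f i))"
  by (induction A rule: finite_induct) (auto simp: H_one H_mult)

lemma H_diff_eqI:
  assumes "H x = H (y + z)"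
  shows "H (x - y) = H z"
proof -
  have "H (x - y) = H x \<oplus> H (- y)"
    by (metis H_add add_uminus_conv_diff)
  also have "\<dots> = H (y + z + - y)"
    unfolding assms by (simp only: H_add)
  finally show ?thesis by simp
qed

text \<open>Serves to divide out a cleared denominator \<open>r\<close> that has become invertible
  modulo \<open>p\<close>.\<close>

lemma H_unit_cancel:
  assumes "H (u * r) = \<one>" "H (r * x) = H y"
  shows "H x = H (u * y)"
proof -
  have "H x = H (u * r) \<otimes> H x"
    by (simp only: assms(1) l_one H_closed)
  also have "\<dots> = H u \<otimes> H (r * x)"
    by (simp add: H_mult m_assoc)
  also have "\<dots> = H (u * y)"
    by (simp only: assms(2) H_mult[of u])
  finally show ?thesis .
qed

lemma H_power_one: "H x = \<one> \<Longrightarrow> H (x ^ k) = \<one>"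
  by (induction k) (auto simp: H_mult H_one)

text \<open>Divisibility of the images, with the quotient taken from the image of \<open>H\<close>;
  it is divisibility in \<open>S\<close> once \<open>H\<close> is onto.\<close>

definition hdvd :: "'r \<Rightarrow> 'r \<Rightarrow> bool" where
  "hdvd x y \<longleftrightarrow> (\<exists>q. H y = H (x * q))"

lemma hdvdI: "H y = H (x * q) \<Longrightarrow> hdvd x y"
  unfolding hdvd_def by blast

lemma hdvd_cong: "H x = H x' \<Longrightarrow> H y = H y' \<Longrightarrow> hdvd x y \<longleftrightarrow> hdvd x' y'"
  by (simp add: hdvd_def H_mult)

lemma dvd_imp_hdvd: "x dvd y \<Longrightarrow> hdvd x y"
  unfolding hdvd_def dvd_def by blast

lemma hdvd_trans:
  assumes "hdvd x y" "hdvd y z"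
  shows "hdvd x z"
proof -
  obtain p q where "H y = H (x * p)" "H z = H (y * q)"
    using assms unfolding hdvd_def by blast
  then have "H z = H (x * (p * q))"
    by (simp add: H_mult m_assoc)
  then show ?thesis by (rule hdvdI)
qed

lemma hdvd_mult: "hdvd x y \<Longrightarrow> hdvd x (z * y)"
  by (rule hdvd_trans[OF _ dvd_imp_hdvd]) auto

lemma hdvd_mult2: "hdvd x y \<Longrightarrow> hdvd x (y * z)"
  by (rule hdvd_trans[OF _ dvd_imp_hdvd]) auto

lemma hdvd_add:
  assumes "hdvd x y" "hdvd x z"
  shows "hdvd x (y + z)"
proof -
  obtain p q where "H y = H (x * p)" "H z = H (x * q)"
    using assms unfolding hdvd_def by blast
  then have "H (y + z) = H (x * (p + q))"
    by (simp add: H_add distrib_left)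
  then show ?thesis by (rule hdvdI)
qed

lemma hdvd_sum: "(\<And>i. i \<in> A \<Longrightarrow> hdvd x (f i)) \<Longrightarrow> hdvd x (sum f A)"
  by (induction A rule: infinite_finite_induct) (auto intro: hdvd_add dvd_imp_hdvd)

lemma hdvd_cancel:
  assumes "hdvd (x * y) (x * z)" "H x \<noteq> \<zero>"
  shows "hdvd y z"
proof -
  obtain q where "H (x * z) = H (x * y * q)"
    using assms unfolding hdvd_def by blast
  then have "H (x * z) = H (x * (y * q))"
    by (simp add: mult.assoc)
  then show ?thesis
    using H_cancel assms(2) hdvdI by blast
qed

end

section \<open>Logarithmic derivations and the determinant criterion\<close>

text \<open>
  The elements \<open>\<alpha> k\<close> are the equations of the hyperplanes and \<open>a k j\<close> is the partial derivative
  of \<open>\<alpha> k\<close> in direction \<open>j\<close>. Everything is expressed through representatives in a type of class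
  \<open>comm_ring_1\<close>, up to the kernel of \<open>H\<close>, because determinants are available there.
\<close>

locale saito = domain_hom S H for S :: "('a, 'm) ring_scheme" (structure) and H :: "'r::comm_ring_1 \<Rightarrow> 'a" +
  fixes l n :: nat and \<alpha> :: "nat \<Rightarrow> 'r" and a :: "nat \<Rightarrow> nat \<Rightarrow> 'r"
  assumes coeff_unit: "k < n \<Longrightarrow> \<exists>j<l. \<exists>u. H (a k j * u) = \<one>"
    and form_prime: "k < n \<Longrightarrow> hdvd (\<alpha> k) (x * y) \<Longrightarrow> hdvd (\<alpha> k) x \<or> hdvd (\<alpha> k) y"
    and form_nonunit: "k < n \<Longrightarrow> \<not> hdvd (\<alpha> k) 1"
    and form_nonzero: "k < n \<Longrightarrow> H (\<alpha> k) \<noteq> \<zero>"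
    and form_not_hdvd: "k < n \<Longrightarrow> k' < n \<Longrightarrow> k \<noteq> k' \<Longrightarrow> \<not> hdvd (\<alpha> k) (\<alpha> k')"
begin

abbreviation Q :: 'r where "Q \<equiv> \<Prod>k<n. \<alpha> k"

definition logarithmic :: "(nat \<Rightarrow> 'r) \<Rightarrow> bool" where
  "logarithmic \<delta> \<longleftrightarrow> (\<forall>k<n. hdvd (\<alpha> k) (\<Sum>j<l. \<delta> j * a k j))"

definition log_rows :: "'r mat \<Rightarrow> bool" where
  "log_rows M \<longleftrightarrow> M \<in> carrier_mat l l \<and> (\<forall>i<l. logarithmic (\<lambda>j. M $$ (i,j)))"

lemma logarithmic_zero: "logarithmic (\<lambda>j. 0)"
  by (simp add: logarithmic_def dvd_imp_hdvd)

lemma logarithmic_add: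
  assumes "logarithmic \<delta>" "logarithmic \<epsilon>"
  shows "logarithmic (\<lambda>j. \<delta> j + \<epsilon> j)"
  unfolding logarithmic_def
proof (intro allI impI)
  fix k assume "k < n"
  then have "hdvd (\<alpha> k) ((\<Sum>j<l. \<delta> j * a k j) + (\<Sum>j<l. \<epsilon> j * a k j))"
    using assms unfolding logarithmic_def by (intro hdvd_add) auto
  then show "hdvd (\<alpha> k) (\<Sum>j<l. (\<delta> j + \<epsilon> j) * a k j)"
    by (simp add: distrib_right sum.distrib)
qed

lemma logarithmic_mult:
  assumes "logarithmic \<delta>"
  shows "logarithmic (\<lambda>j. f * \<delta> j)"
  unfolding logarithmic_def
proof (intro allI impI)
  fix k assume "k < n"
  then have "hdvd (\<alpha> k) (f * (\<Sum>j<l. \<delta> j * a k j))"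
    using assms unfolding logarithmic_def by (intro hdvd_mult) auto
  then show "hdvd (\<alpha> k) (\<Sum>j<l. f * \<delta> j * a k j)"
    by (simp add: sum_distrib_left mult.assoc)
qed

lemma Q_nonzero: "H Q \<noteq> \<zero>"
  by (rule H_prod_nonzero) (simp add: form_nonzero)

lemma form_not_hdvd_prod:
  assumes "k < n" "A \<subseteq> {..<n} - {k}"
  shows "\<not> hdvd (\<alpha> k) (prod \<alpha> A)"
  using finite_subset[OF assms(2) finite_Diff[OF finite_lessThan]] assms(2)
proof (induction A rule: finite_induct)
  case empty
  then show ?case using form_nonunit[OF assms(1)] by simp
next
  case (insert x A)
  then show ?case using form_prime[OF assms(1)] form_not_hdvd[OF assms(1), of x] by auto
qed

lemma form_hdvd_power:
  assumes "k < n" "hdvd (\<alpha> k) (x ^ m)"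
  shows "hdvd (\<alpha> k) x"
  using assms(2) by (induction m) (use form_nonunit[OF assms(1)] form_prime[OF assms(1)] in auto)

text \<open>The forms are pairwise non-associated primes. By induction the next form divides the
  product of the earlier ones times a quotient, but not that product, so it divides the
  quotient.\<close>

lemma Q_hdvd:
  assumes "\<And>k. k < n \<Longrightarrow> hdvd (\<alpha> k) x"
  shows "hdvd Q x"
proof -
  have "hdvd (\<Prod>k<m. \<alpha> k) x" if "m \<le> n" for m
    using that
  proof (induction m)
    case 0
    then show ?case by (simp add: dvd_imp_hdvd)
  next
    case (Suc m)
    then obtain q where q: "H x = H ((\<Prod>k<m. \<alpha> k) * q)"
      unfolding hdvd_def by auto
    have "hdvd (\<alpha> m) ((\<Prod>k<m. \<alpha> k) * q)"
      using assms[of m] Suc.prems hdvd_cong[OF refl q] by simp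
    moreover have "\<not> hdvd (\<alpha> m) (\<Prod>k<m. \<alpha> k)"
      using Suc.prems by (intro form_not_hdvd_prod) auto
    ultimately have "hdvd (\<alpha> m) q"
      using form_prime[of m] Suc.prems by auto
    then obtain r where "H q = H (\<alpha> m * r)"
      unfolding hdvd_def by blast
    then have "H x = H ((\<Prod>k<Suc m. \<alpha> k) * r)"
      using q by (simp add: H_mult m_assoc)
    then show ?case by (rule hdvdI)
  qed
  then show ?thesis by simp
qed

text \<open>Applying \<open>M\<close> to the column of the \<open>a k j\<close> gives a column of
  multiples of \<open>\<alpha> k\<close>. The adjugate turns it into \<open>det M\<close> times the
  original column, one of whose entries is a unit.\<close>

lemma form_hdvd_det:
  assumes "log_rows M" "k < n"
  shows "hdvd (\<alpha> k) (det M)"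
proof -
  have M: "M \<in> carrier_mat l l"
    using assms by (simp add: log_rows_def)
  obtain j u where j: "j < l" and u: "H (a k j * u) = \<one>"
    using coeff_unit[OF assms(2)] by blast
  have "(\<Sum>i<l. adj_mat M $$ (j,i) * (\<Sum>j'<l. M $$ (i,j') * a k j'))
      = (\<Sum>j'<l. (\<Sum>i<l. adj_mat M $$ (j,i) * M $$ (i,j')) * a k j')"
    unfolding sum_distrib_left sum_distrib_right by (subst sum.swap) (simp add: mult.assoc)
  also have "\<dots> = (\<Sum>j'<l. (if j = j' then det M * a k j' else 0))"
    by (intro sum.cong) (auto simp: adj_mat_mult_sum(1)[OF M j])
  also have "\<dots> = det M * a k j"
    using j by simp
  finally have eq: "det M * a k j = (\<Sum>i<l. adj_mat M $$ (j,i) * (\<Sum>j'<l. M $$ (i,j') * a k j'))"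
    by simp
  have "hdvd (\<alpha> k) (det M * a k j)"
    unfolding eq using assms
    by (intro hdvd_sum, intro hdvd_mult) (auto simp: log_rows_def logarithmic_def)
  then have "hdvd (\<alpha> k) (det M * a k j * u)"
    by (rule hdvd_mult2)
  moreover have "H (det M * a k j * u) = H (det M)"
    using u by (simp add: H_mult m_assoc)
  ultimately show ?thesis
    using hdvd_cong by blast
qed

lemma Q_hdvd_det: "log_rows M \<Longrightarrow> hdvd Q (det M)"
  by (intro Q_hdvd form_hdvd_det)

text \<open>Cramer's rule: replacing a row by \<open>\<eta>\<close> keeps all rows logarithmic, so
  each numerator is divisible by \<open>Q\<close>. As \<open>det M\<close> is a unit times
  \<open>Q\<close>, the divisions can be carried out.\<close>

theorem saito_spanning:
  assumes M: "log_rows M" and \<eta>: "logarithmic \<eta>"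
    and det: "H (det M) = H (c * Q)" and unit: "H (c * c') = \<one>"
  shows "\<exists>h. \<forall>j<l. H (\<eta> j) = H (\<Sum>i<l. h i * M $$ (i,j))"
proof -
  have Mc: "M \<in> carrier_mat l l"
    using M by (simp add: log_rows_def)
  let ?d = "\<lambda>i. \<Sum>j<l. \<eta> j * adj_mat M $$ (j,i)"
  have "\<exists>q. H (?d i) = H (Q * q)" if "i < l" for i
  proof -
    have "log_rows (mat l l (\<lambda>(r,j). if r = i then \<eta> j else M $$ (r,j)))"
      unfolding log_rows_def
    proof (intro conjI allI impI)
      fix r assume "r < l"
      then show "logarithmic (\<lambda>j. mat l l (\<lambda>(r,j). if r = i then \<eta> j else M $$ (r,j)) $$ (r,j))"
        using M \<eta> by (cases "r = i") (auto simp: logarithmic_def log_rows_def)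
    qed simp
    from Q_hdvd_det[OF this] show ?thesis
      unfolding det_replace_row[OF Mc that] by (simp add: hdvd_def)
  qed
  then obtain q where q: "\<And>i. i < l \<Longrightarrow> H (?d i) = H (Q * q i)"
    by metis
  have "H (\<eta> j) = H (\<Sum>i<l. c' * q i * M $$ (i,j))" if j: "j < l" for j
  proof -
    have "(\<Sum>i<l. ?d i * M $$ (i,j)) = (\<Sum>j'<l. \<eta> j' * (\<Sum>i<l. adj_mat M $$ (j',i) * M $$ (i,j)))"
      unfolding sum_distrib_left sum_distrib_right by (subst sum.swap) (simp add: mult.assoc)
    also have "\<dots> = (\<Sum>j'<l. (if j' = j then \<eta> j' * det M else 0))"
      by (intro sum.cong) (auto simp: adj_mat_mult_sum(1)[OF Mc _ j])
    also have "\<dots> = \<eta> j * det M"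
      using j by simp
    finally have 1: "(\<Sum>i<l. ?d i * M $$ (i,j)) = \<eta> j * det M" .
    \<comment> \<open>Both sides of Cramer's identity carry the factor \<open>Q\<close>, which
      cancels in a domain; then \<open>c'\<close> removes the unit.\<close>
    have "H (Q * (c * \<eta> j)) = H (\<eta> j * det M)"
      using det by (simp add: H_mult m_ac)
    also have "\<dots> = H (\<Sum>i<l. Q * q i * M $$ (i,j))"
      unfolding 1[symmetric] by (rule H_sum_cong) (simp add: H_mult q)
    also have "\<dots> = H (Q * (\<Sum>i<l. q i * M $$ (i,j)))"
      by (simp add: sum_distrib_left mult.assoc)
    finally have c\<eta>: "H (c * \<eta> j) = H (\<Sum>i<l. q i * M $$ (i,j))"
      using H_cancel Q_nonzero by blast
    have "H (c' * (\<Sum>i<l. q i * M $$ (i,j))) = H c' \<otimes> H (c * \<eta> j)"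
      by (simp only: H_mult[of c'] c\<eta>)
    also have "\<dots> = H (c * c' * \<eta> j)"
      by (simp add: H_mult m_ac)
    also have "\<dots> = H (\<eta> j)"
      unfolding H_mult[of "c * c'"] unit by simp
    finally have "H (\<eta> j) = H (c' * (\<Sum>i<l. q i * M $$ (i,j)))" ..
    then show ?thesis
      unfolding sum_distrib_left mult.assoc .
  qed
  then show ?thesis
    by (intro exI[of _ "\<lambda>i. c' * q i"]) blast
qed

text \<open>Multiplying a relation between the rows by the adjugate leaves \<open>det M\<close>
  times each coefficient, and \<open>H (det M)\<close> is nonzero in a domain.\<close>

theorem saito_independent:
  assumes M: "M \<in> carrier_mat l l" and det: "H (det M) = H (c * Q)" and unit: "H (c * c') = \<one>"
    and zero: "\<And>j. j < l \<Longrightarrow> H (\<Sum>i<l. h i * M $$ (i,j)) = \<zero>" and i: "i < l"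
  shows "H (h i) = \<zero>"
proof -
  have "(\<Sum>j<l. (\<Sum>r<l. h r * M $$ (r,j)) * adj_mat M $$ (j,i))
      = (\<Sum>r<l. h r * (\<Sum>j<l. M $$ (r,j) * adj_mat M $$ (j,i)))"
    unfolding sum_distrib_left sum_distrib_right by (subst sum.swap) (simp add: mult.assoc)
  also have "\<dots> = (\<Sum>r<l. (if r = i then h r * det M else 0))"
    by (intro sum.cong) (auto simp: adj_mat_mult_sum(2)[OF M _ i])
  also have "\<dots> = h i * det M"
    using i by simp
  finally have "H (h i * det M) = H (\<Sum>j<l. (\<Sum>r<l. h r * M $$ (r,j)) * adj_mat M $$ (j,i))"
    by simp
  also have "\<dots> = H (\<Sum>j<l. 0)"
    by (rule H_sum_cong) (simp add: H_mult zero H_zero)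
  finally have "H (h i) \<otimes> H (det M) = \<zero>"
    by (simp add: H_mult H_zero)
  moreover have "H (det M) \<noteq> \<zero>"
    using det unit Q_nonzero by (auto simp: H_mult integral_iff)
  ultimately show ?thesis
    by (simp add: integral_iff)
qed

text \<open>Replaces an argument by coprimality: in \<open>\<alpha> k ^ m * x = g * q\<close> the
  prime \<open>\<alpha> k\<close> must divide \<open>q\<close>, so one factor at a time can be
  cancelled.\<close>

lemma hdvd_strip_form:
  assumes k: "k < n" and ndvd: "\<not> hdvd (\<alpha> k) g" and dvd: "hdvd g (\<alpha> k ^ m * x)"
  shows "hdvd g x"
  using dvd
proof (induction m)
  case (Suc m)
  then obtain q where q: "H (\<alpha> k ^ Suc m * x) = H (g * q)"
    unfolding hdvd_def by blast
  have "hdvd (\<alpha> k) (\<alpha> k ^ Suc m * x)"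
    by (intro dvd_imp_hdvd) simp
  then have "hdvd (\<alpha> k) (g * q)"
    using hdvd_cong[OF refl q] by simp
  then obtain r where "H q = H (\<alpha> k * r)"
    using form_prime[OF k] ndvd unfolding hdvd_def by blast
  then have "H (\<alpha> k * (\<alpha> k ^ m * x)) = H (\<alpha> k * (g * r))"
    using q by (simp add: H_mult m_ac)
  then have "hdvd g (\<alpha> k ^ m * x)"
    using H_cancel form_nonzero[OF k] hdvdI by blast
  then show ?case by (rule Suc.IH)
qed simp

text \<open>Expressing each row of \<open>N\<close> through the rows of \<open>M\<close> gives a
  transition matrix \<open>C\<close> with \<open>N\<close> equal to \<open>C * M\<close> up to the
  kernel of \<open>H\<close>; the quotient is \<open>det C\<close>.\<close>

lemma det_hdvd_det:
  assumes M: "M \<in> carrier_mat l l" and N: "log_rows N"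
    and span: "\<And>\<eta>. logarithmic \<eta> \<Longrightarrow> \<exists>h. \<forall>j<l. H (\<eta> j) = H (\<Sum>i<l. h i * M $$ (i,j))"
  shows "hdvd (det M) (det N)"
proof -
  have "\<exists>h. \<forall>j<l. H (N $$ (r,j)) = H (\<Sum>i<l. h i * M $$ (i,j))" if "r < l" for r
    using span N that by (auto simp: log_rows_def)
  then obtain h where h: "\<And>r j. r < l \<Longrightarrow> j < l \<Longrightarrow> H (N $$ (r,j)) = H (\<Sum>i<l. h r i * M $$ (i,j))"
    by metis
  define C where "C = mat l l (\<lambda>(r,i). h r i)"
  have C: "C \<in> carrier_mat l l"
    by (simp add: C_def)
  have "H (det N) = H (det (C * M))"
  proof (rule H_det_cong)
    fix r j assume "r < l" "j < l"
    then show "H (N $$ (r,j)) = H ((C * M) $$ (r,j))"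
      using M by (simp add: h C_def scalar_prod_def atLeast0LessThan)
  qed (use M C N in \<open>auto simp: log_rows_def\<close>)
  then have "H (det N) = H (det M * det C)"
    by (simp add: det_mult[OF C M] mult.commute)
  then show ?thesis by (rule hdvdI)
qed

text \<open>
  Which power of \<open>\<alpha> k\<close> divides \<open>det M\<close> is bounded by testing with derivations whose determinant
  contains \<open>\<alpha> k\<close> only once: with \<open>P = Q / \<alpha> k\<close> and \<open>b\<close> the coefficient of \<open>\<alpha> k\<close> at \<open>x\<^sub>s\<close>, these are
  \<open>Q \<partial>\<^sub>s\<close> and \<open>P (b \<partial>\<^sub>i - a k i \<partial>\<^sub>s)\<close> for \<open>i \<noteq> s\<close>.
\<close>

lemma det_hdvd_test:
  assumes M: "M \<in> carrier_mat l l" and k: "k < n" and s: "s < l"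
    and span: "\<And>\<eta>. logarithmic \<eta> \<Longrightarrow> \<exists>h. \<forall>j<l. H (\<eta> j) = H (\<Sum>i<l. h i * M $$ (i,j))"
  shows "hdvd (det M) (Q * (prod \<alpha> ({..<n} - {k}) * a k s) ^ (l - 1))"
proof -
  define P where "P = prod \<alpha> ({..<n} - {k})"
  have Q: "Q = \<alpha> k * P"
    unfolding P_def using k by (simp add: prod.remove)
  define N where "N = mat l l (\<lambda>(i,j). if i = s then (if j = s then Q else 0)
    else (if j = i then P * a k s else if j = s then - (P * a k i) else 0))"
  have N: "N \<in> carrier_mat l l"
    by (simp add: N_def)
  have "log_rows N"
    unfolding log_rows_def logarithmic_def
  proof (intro conjI allI impI)
    fix i k' assume i: "i < l" and k': "k' < n"
    show "hdvd (\<alpha> k') (\<Sum>j<l. N $$ (i,j) * a k' j)"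
    proof (cases "i = s")
      case True
      have "\<alpha> k' dvd Q"
        using k' by (intro dvd_prodI) auto
      then show ?thesis
        using True s by (intro dvd_imp_hdvd dvd_sum) (simp add: N_def)
    next
      case i_s: False
      \<comment> \<open>Row \<open>i\<close> annihilates \<open>\<alpha> k\<close> exactly, while
        every other form already divides the factor \<open>P\<close>.\<close>
      show ?thesis
      proof (cases "k' = k")
        case True
        have "(\<Sum>j<l. N $$ (i,j) * a k' j)
            = (\<Sum>j\<in>{i,s}. (if j = i then P * a k s else - (P * a k i)) * a k j)"
          by (rule sum.mono_neutral_cong_right) (use i s i_s True in \<open>auto simp: N_def\<close>)
        also have "\<dots> = 0"
          using i_s by (simp add: mult_ac)
        finally show ?thesis
          by (simp add: dvd_imp_hdvd)
      next
        case False
        then have "\<alpha> k' dvd P"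
          unfolding P_def using k' by (intro dvd_prodI) auto
        then show ?thesis
          using i_s i s by (intro dvd_imp_hdvd dvd_sum) (simp add: N_def)
      qed
    qed
  qed (rule N)
  then have "hdvd (det M) (det N)"
    by (rule det_hdvd_det[OF M _ span])
  \<comment> \<open>Row \<open>s\<close> has its only possibly nonzero entry on the diagonal, and
    all other off-diagonal entries lie in column \<open>s\<close>, so the remaining minor is scalar
    of size \<open>l - 1\<close>.\<close>
  also have "det N = (\<Sum>j<l. N $$ (s,j) * cofactor N s j)"
    by (rule laplace_expansion_row[OF N s])
  also have "\<dots> = (\<Sum>j<l. if j = s then Q * cofactor N s j else 0)"
    using s by (intro sum.cong) (auto simp: N_def)
  also have "\<dots> = Q * cofactor N s s"
    using s by simp
  also have "mat_delete N s s = (P * a k s) \<cdot>\<^sub>m 1\<^sub>m (l - 1)"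
    using s by (auto simp: N_def mat_delete_def intro!: eq_matI)
  then have "cofactor N s s = (P * a k s) ^ (l - 1)"
    by (simp add: cofactor_def mult_2[symmetric])
  finally show ?thesis
    by (simp add: P_def)
qed

text \<open>Write \<open>det M\<close> as \<open>Q * g\<close>. No form divides \<open>g\<close>,
  and yet \<open>g\<close> divides a power of \<open>Q\<close>; stripping the forms from that power
  leaves \<open>g\<close> dividing 1.\<close>

theorem saito_det:
  assumes M: "log_rows M"
    and span: "\<And>\<eta>. logarithmic \<eta> \<Longrightarrow> \<exists>h. \<forall>j<l. H (\<eta> j) = H (\<Sum>i<l. h i * M $$ (i,j))"
  shows "\<exists>c c'. H (det M) = H (c * Q) \<and> H (c * c') = \<one>"
proof -
  have Mc: "M \<in> carrier_mat l l"
    using M by (simp add: log_rows_def)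
  obtain g where g: "H (det M) = H (Q * g)"
    using Q_hdvd_det[OF M] unfolding hdvd_def by blast
  \<comment> \<open>Once \<open>Q\<close> is cancelled from the test determinant, \<open>g\<close>
    divides a power of \<open>Q / \<alpha> k\<close> times a unit coefficient, in which
    \<open>\<alpha> k\<close> does not occur.\<close>
  have g_form: "\<not> hdvd (\<alpha> k) g" if k: "k < n" for k
  proof
    assume "hdvd (\<alpha> k) g"
    obtain s u where s: "s < l" and u: "H (a k s * u) = \<one>"
      using coeff_unit[OF k] by blast
    let ?b = "prod \<alpha> ({..<n} - {k}) * a k s"
    have "hdvd (Q * g) (Q * ?b ^ (l - 1))"
      using det_hdvd_test[OF Mc k s span] hdvd_cong[OF g refl] by simp
    then have "hdvd g (?b ^ (l - 1))"
      using hdvd_cancel Q_nonzero by blast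
    then have "hdvd (\<alpha> k) ?b"
      using hdvd_trans[OF \<open>hdvd (\<alpha> k) g\<close>] form_hdvd_power[OF k] by blast
    then have "hdvd (\<alpha> k) (a k s)"
      using form_prime[OF k] form_not_hdvd_prod[OF k] by blast
    then have "hdvd (\<alpha> k) (a k s * u)"
      by (rule hdvd_mult2)
    then show False
      using form_nonunit[OF k] hdvd_cong[of "\<alpha> k" "\<alpha> k" "a k s * u" 1] u by (simp add: H_one)
  qed
  \<comment> \<open>The derivations \<open>Q\<close> times a coordinate derivation are always
    logarithmic; their determinant \<open>Q ^ l\<close> supplies the power of
    \<open>Q\<close>.\<close>
  have "log_rows (Q \<cdot>\<^sub>m 1\<^sub>m l)"
    unfolding log_rows_def logarithmic_def
  proof (intro conjI allI impI)
    fix i k assume "i < l" "k < n"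
    then have "\<alpha> k dvd Q"
      by (intro dvd_prodI) auto
    then show "hdvd (\<alpha> k) (\<Sum>j<l. (Q \<cdot>\<^sub>m 1\<^sub>m l) $$ (i,j) * a k j)"
      using \<open>i < l\<close> by (intro dvd_imp_hdvd dvd_sum) simp
  qed simp
  from det_hdvd_det[OF Mc this span] have "hdvd (det M) (Q ^ l)"
    by simp
  then have "hdvd (Q * g) (Q ^ l)"
    using hdvd_cong[OF g refl] by simp
  have "hdvd g (Q * g)"
    by (intro dvd_imp_hdvd) simp
  then have "hdvd g (Q ^ l)"
    using \<open>hdvd (Q * g) (Q ^ l)\<close> by (rule hdvd_trans)
  then have "hdvd g (\<Prod>k<n. \<alpha> k ^ l)"
    by (simp only: prod_power_distrib)
  have strip: "hdvd g 1" if "hdvd g (\<Prod>k<m. \<alpha> k ^ l)" "m \<le> n" for m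
    using that
  proof (induction m)
    case (Suc m)
    then have "hdvd g (\<alpha> m ^ l * (\<Prod>k<m. \<alpha> k ^ l))"
      by (simp add: mult.commute)
    moreover have m: "m < n"
      using Suc.prems by simp
    ultimately have "hdvd g (\<Prod>k<m. \<alpha> k ^ l)"
      using hdvd_strip_form[OF m g_form[OF m]] by blast
    with Suc show ?case
      by simp
  qed simp
  have "hdvd g 1"
    by (rule strip[OF \<open>hdvd g (\<Prod>k<n. \<alpha> k ^ l)\<close> order.refl])
  then obtain c' where "\<one> = H (g * c')"
    unfolding hdvd_def H_one by blast
  then have "H (det M) = H (g * Q) \<and> H (g * c') = \<one>"
    using g by (simp only: mult.commute[of g])
  then show ?thesis
    by (intro exI)
qed

end

section \<open>Polynomials as finitely supported maps\<close>

abbreviation lookup where "lookup \<equiv> Poly_Mapping.lookup"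
abbreviation keys where "keys \<equiv> Poly_Mapping.keys"
abbreviation single where "single \<equiv> Poly_Mapping.single"

lemma finite_submsets: "finite {a. a \<subseteq># m}"
proof (induction m)
  case (add x m)
  have "{a. a \<subseteq># add_mset x m} \<subseteq> {a. a \<subseteq># m} \<union> add_mset x ` {a. a \<subseteq># m}"
  proof
    fix a assume a: "a \<in> {a. a \<subseteq># add_mset x m}"
    show "a \<in> {a. a \<subseteq># m} \<union> add_mset x ` {a. a \<subseteq># m}"
    proof (cases "x \<in># a")
      case True
      then show ?thesis
        using a by (auto dest!: multi_member_split)
    next
      case False
      then have "a \<subseteq># m"
        using a by (metis diff_single_trivial mem_Collect_eq subset_eq_diff_conv add_mset_add_single)
      then show ?thesis by simp
    qed
  qed
  then show ?case
    using add finite_subset by fastforce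
qed simp

text \<open>Brings the product of finitely supported maps, a sum over pairs of monomials, into the
  shape of \<open>mpoly_mult\<close>.\<close>

lemma lookup_mult_submsets:
  fixes f g :: "'x multiset \<Rightarrow>\<^sub>0 'r::comm_ring_1"
  shows "lookup (f * g) m = (\<Sum>a\<in>{a. a \<subseteq># m}. lookup f a * lookup g (m - a))"
proof -
  have inner: "(\<Sum>q. lookup g q when m = a + q) = (if a \<subseteq># m then lookup g (m - a) else 0)" for a
  proof (cases "a \<subseteq># m")
    case True
    then have "m = a + q \<longleftrightarrow> m - a = q" for q
      by auto
    with True show ?thesis by simp
  next
    case False
    then have "\<not> m = a + q" for q
      by auto
    with False show ?thesis by simp
  qed
  have "lookup (f * g) m = (\<Sum>a. lookup f a * (if a \<subseteq># m then lookup g (m - a) else 0))"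
    by (simp add: lookup_mult inner)
  also have "\<dots> = (\<Sum>a\<in>{a. a \<subseteq># m}. lookup f a * (if a \<subseteq># m then lookup g (m - a) else 0))"
    by (rule Sum_any.expand_superset) (auto simp: finite_submsets)
  finally show ?thesis by simp
qed

lemma lookup_single_add_times:
  fixes g :: "'x multiset \<Rightarrow>\<^sub>0 'r::comm_ring_1"
  shows "lookup (single s c * g) m = (if s \<subseteq># m then c * lookup g (m - s) else 0)"
proof -
  have "lookup (single s c * g) m
      = (\<Sum>a\<in>{a. a \<subseteq># m}. if a = s then c * lookup g (m - a) else 0)"
    unfolding lookup_mult_submsets by (intro sum.cong) (auto simp: lookup_single)
  also have "\<dots> = (if s \<subseteq># m then c * lookup g (m - s) else 0)"
    by (simp add: finite_submsets)
  finally show ?thesis .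
qed

lemma poly_mapping_sum_single:
  "(\<Sum>m\<in>keys f. single m (lookup f m)) = f"
  by (rule poly_mapping_eqI) (auto simp: lookup_sum lookup_single when_def in_keys_iff)

text \<open>Constants and variables generate the polynomials as a ring. Division by a linear form
  and clearing denominators are both compatible with sums and products, so they need checking only
  on generators.\<close>

lemma poly_mapping_induct_ring [case_names const var add mult]:
  fixes f :: "'x multiset \<Rightarrow>\<^sub>0 'r::comm_ring_1"
  assumes const: "\<And>c. P (single {#} c)"
    and var: "\<And>i. P (single {#i#} 1)"
    and add: "\<And>f g. P f \<Longrightarrow> P g \<Longrightarrow> P (f + g)"
    and mult: "\<And>f g. P f \<Longrightarrow> P g \<Longrightarrow> P (f * g)"
  shows "P f"
proof -
  have single: "P (single m c)" for m c
  proof (induction m)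
    case (add i m)
    have "single (add_mset i m) c = single {#i#} 1 * single m c"
      by (simp add: mult_single)
    then show ?case using mult[OF var add.IH] by simp
  qed (rule const)
  have "P (\<Sum>m\<in>A. single m (lookup f m))" if "finite A" for A
    using that
  proof (induction A rule: finite_induct)
    case empty
    then show ?case using const[of 0] by simp
  qed (auto intro: add single)
  from this[OF finite_keys[of f]] show ?thesis
    unfolding poly_mapping_sum_single .
qed

text \<open>
  The source type has infinitely many variables, so that it does not depend on \<open>l\<close>; the superfluous
  ones \<open>x\<^sub>l, x\<^bsub>l+1\<^esub>, \<dots>\<close> are sent to zero.
\<close>

definition coeff_map ::
    "('a, 'm) ring_scheme \<Rightarrow> ('r::comm_ring_1 \<Rightarrow> 'a) \<Rightarrow> nat \<Rightarrow> (nat multiset \<Rightarrow>\<^sub>0 'r) \<Rightarrow> nat multiset \<Rightarrow> 'a" where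
  "coeff_map K h l f = (\<lambda>m. if set_mset m \<subseteq> {..<l} then h (lookup f m) else \<zero>\<^bsub>K\<^esub>)"

text \<open>In the applications \<open>h\<close> is the identity on the integers or the rationals,
  or reduction modulo \<open>p\<close>. Surjectivity of \<open>h\<close> gives every polynomial of
  the record ring a representative.\<close>

locale coeff_cover = domain_hom K h for K :: "('a, 'm) ring_scheme" (structure) and h :: "'r::comm_ring_1 \<Rightarrow> 'a" +
  fixes l :: nat
  assumes surj: "carrier K \<subseteq> range h"
begin

abbreviation P where "P \<equiv> mpoly_ring K l"
abbreviation T where "T \<equiv> coeff_map K h l"

lemma coeff_map_closed_coeff [simp]: "T f m \<in> carrier K"
  by (simp add: coeff_map_def)

lemma finite_coeff_map_support: "finite {m. T f m \<noteq> \<zero>}"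
  by (rule finite_subset[OF _ finite_keys[of f]]) (auto simp: coeff_map_def in_keys_iff H_zero)

lemma coeff_map_zero: "T 0 = indexed_const \<zero>"
  by (auto simp: coeff_map_def H_zero indexed_const_def)

lemma coeff_map_one: "T 1 = indexed_const \<one>"
  by (auto simp: coeff_map_def H_one H_zero lookup_one indexed_const_def when_def)

lemma coeff_map_add: "T (f + g) = indexed_padd (T f) (T g)"
  by (auto simp: coeff_map_def H_add lookup_add indexed_padd_def)

lemma coeff_map_mult: "T (f * g) = mpoly_mult K (T f) (T g)"
proof
  fix m
  show "T (f * g) m = mpoly_mult K (T f) (T g) m"
  proof (cases "set_mset m \<subseteq> {..<l}")
    case True
    have "T (f * g) m = (\<Oplus>a\<in>{a. a \<subseteq># m}. h (lookup f a * lookup g (m - a)))"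
      using True by (simp add: coeff_map_def lookup_mult_submsets H_sum finite_submsets)
    also have "\<dots> = mpoly_mult K (T f) (T g) m"
      unfolding mpoly_mult_def
    proof (rule finsum_cong')
      fix a assume "a \<in> {a. a \<subseteq># m}"
      then have "set_mset a \<subseteq> {..<l}" "set_mset (m - a) \<subseteq> {..<l}"
        using True by (auto dest: set_mset_mono in_diffD)
      then show "h (lookup f a * lookup g (m - a)) = T f a \<otimes> T g (m - a)"
        by (simp add: coeff_map_def H_mult)
    qed auto
    finally show ?thesis .
  next
    case False
    have "mpoly_mult K (T f) (T g) m = \<zero>"
      unfolding mpoly_mult_def
    proof (rule add.finprod_one_eqI)
      fix a assume "a \<in> {a. a \<subseteq># m}"
      then have "a + (m - a) = m" by simp
      then have "\<not> set_mset a \<subseteq> {..<l} \<or> \<not> set_mset (m - a) \<subseteq> {..<l}"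
        using False by (metis set_mset_union Un_least)
      then show "T f a \<otimes> T g (m - a) = \<zero>"
        by (auto simp: coeff_map_def)
    qed
    with False show ?thesis
      by (simp add: coeff_map_def)
  qed
qed

lemma coeff_map_var_mult:
  "T (single {#i#} 1 * f) = (if i < l then indexed_pmult (T f) i else indexed_const \<zero>)"
proof
  fix m
  show "T (single {#i#} 1 * f) m
      = (if i < l then indexed_pmult (T f) i else indexed_const \<zero>) m"
  proof (cases "i \<in># m")
    case True
    then obtain m' where "m = add_mset i m'"
      by (blast dest: multi_member_split)
    then show ?thesis
      by (auto simp: coeff_map_def lookup_single_add_times indexed_pmult_def indexed_const_def)
  qed (simp add: coeff_map_def lookup_single_add_times H_zero indexed_pmult_def indexed_const_def)
qed

lemma coeff_map_const: "T (single {#} c) = indexed_const (h c)"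
  by (auto simp: coeff_map_def lookup_single H_zero indexed_const_def when_def)

lemma coeff_map_in_pset: "T f \<in> indexed_pset {..<l} (carrier K)"
proof -
  have single: "T (single m c) \<in> indexed_pset {..<l} (carrier K)" for m c
  proof (induction m)
    case empty
    then show ?case
      by (simp add: coeff_map_const indexed_const)
  next
    case (add i m)
    have "single (add_mset i m) c = single {#i#} 1 * single m c"
      by (simp add: mult_single)
    then show ?case
      using add by (auto simp: coeff_map_var_mult intro: indexed_pmult indexed_const)
  qed
  have "T (\<Sum>m\<in>A. single m (lookup f m)) \<in> indexed_pset {..<l} (carrier K)"
    if "finite A" for A
    using that
    by (induction A rule: finite_induct)
      (auto simp: coeff_map_zero coeff_map_add intro: indexed_const indexed_padd single)
  from this[OF finite_keys[of f]] show ?thesis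
    unfolding poly_mapping_sum_single .
qed

lemma pset_imp_coeff_map: "x \<in> indexed_pset {..<l} (carrier K) \<Longrightarrow> \<exists>f. x = T f"
proof (induction rule: indexed_pset.induct)
  case (indexed_const k)
  then obtain c where "k = h c"
    using surj by blast
  then show ?case
    by (metis coeff_map_const)
next
  case (indexed_padd p q)
  then show ?case
    by (metis coeff_map_add)
next
  case (indexed_pmult p i)
  then show ?case
    by (metis coeff_map_var_mult lessThan_iff)
qed

lemma carrier_P: "carrier P = range T"
  unfolding mpoly_ring_def using coeff_map_in_pset pset_imp_coeff_map
  by (simp add: image_def) blast

lemma T_closed: "T f \<in> carrier P"
  by (simp add: carrier_P)

lemma T_add: "T (f + g) = T f \<oplus>\<^bsub>P\<^esub> T g"
  by (simp add: mpoly_ring_def coeff_map_add)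

lemma T_mult: "T (f * g) = T f \<otimes>\<^bsub>P\<^esub> T g"
  by (simp add: mpoly_ring_def coeff_map_mult)

lemma T_one: "T 1 = \<one>\<^bsub>P\<^esub>"
  by (simp add: mpoly_ring_def coeff_map_one)

lemma T_zero: "T 0 = \<zero>\<^bsub>P\<^esub>"
  by (simp add: mpoly_ring_def coeff_map_zero)

text \<open>The record ring is the image of a commutative ring under a map that respects the
  operations, so it inherits the ring laws.\<close>

lemma cring_P: "cring P"
proof (rule cringI)
  have inverse: "T (- f + f) = \<zero>\<^bsub>P\<^esub>" for f
    by (simp add: T_zero)
  show "abelian_group P"
  proof (rule abelian_groupI)
    fix x assume "x \<in> carrier P"
    then obtain f where "x = T f"
      by (auto simp: carrier_P)
    then have "T (- f) \<oplus>\<^bsub>P\<^esub> x = \<zero>\<^bsub>P\<^esub>"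
      using inverse[of f] by (simp only: T_add)
    then show "\<exists>y\<in>carrier P. y \<oplus>\<^bsub>P\<^esub> x = \<zero>\<^bsub>P\<^esub>"
      using T_closed by (intro bexI[of _ "T (- f)"])
  qed (auto simp: carrier_P T_add[symmetric] T_zero[symmetric] add_ac)
  show "comm_monoid P"
    by (rule comm_monoidI)
      (auto simp: carrier_P T_mult[symmetric] T_one[symmetric] mult_ac)
qed (auto simp: carrier_P T_add[symmetric] T_mult[symmetric] distrib_right)

text \<open>The product of the leading coefficients for the multiset order does not vanish.\<close>

lemma T_integral:
  assumes fg: "T (f * g) = \<zero>\<^bsub>P\<^esub>" and f: "T f \<noteq> \<zero>\<^bsub>P\<^esub>" and g: "T g \<noteq> \<zero>\<^bsub>P\<^esub>"
  shows False
proof -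
  have zero: "\<zero>\<^bsub>P\<^esub> = (\<lambda>_. \<zero>)"
    by (simp add: mpoly_ring_def indexed_zero_def)
  define m where "m = Max {m. T f m \<noteq> \<zero>}"
  define k where "k = Max {m. T g m \<noteq> \<zero>}"
  have "{m. T f m \<noteq> \<zero>} \<noteq> {}" "{m. T g m \<noteq> \<zero>} \<noteq> {}"
    using f g by (auto simp: zero fun_eq_iff)
  then have m: "T f m \<noteq> \<zero>" and k: "T g k \<noteq> \<zero>"
    using Max_in[OF finite_coeff_map_support[of f]] Max_in[OF finite_coeff_map_support[of g]]
    by (auto simp: m_def k_def)
  have m_max: "a \<le> m" if "T f a \<noteq> \<zero>" for a
    unfolding m_def using that finite_coeff_map_support by (intro Max_ge) auto
  have k_max: "a \<le> k" if "T g a \<noteq> \<zero>" for a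
    unfolding k_def using that finite_coeff_map_support by (intro Max_ge) auto
  have "T (f * g) (m + k) = (\<Oplus>a\<in>{a. a \<subseteq># m + k}. T f a \<otimes> T g (m + k - a))"
    by (simp add: coeff_map_mult mpoly_mult_def)
  also have "\<dots> = (\<Oplus>a\<in>{a. a \<subseteq># m + k}. if a = m then T f a \<otimes> T g (m + k - a) else \<zero>)"
  proof (rule finsum_cong')
    fix a assume a: "a \<in> {a. a \<subseteq># m + k}"
    show "T f a \<otimes> T g (m + k - a) = (if a = m then T f a \<otimes> T g (m + k - a) else \<zero>)"
    proof (rule ccontr)
      assume neq: "\<not> ?thesis"
      then have "a \<noteq> m" "T f a \<noteq> \<zero>" "T g (m + k - a) \<noteq> \<zero>"
        by (auto split: if_splits)
      \<comment> \<open>By maximality, a second contributing splitting of \<open>m + k\<close> would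
        have a sum smaller than \<open>m + k\<close>.\<close>
      then have "a < m" "m + k - a \<le> k"
        using m_max[of a] k_max by auto
      then have "a + (m + k - a) < m + k"
        by (rule add_less_le_mono)
      with a show False by simp
    qed
  qed auto
  also have "\<dots> = T f m \<otimes> T g (m + k - m)"
    by (rule add.finprod_singleton_swap) (auto simp: finite_submsets)
  finally have "T f m \<otimes> T g k = \<zero>"
    using fun_cong[OF fg, of "m + k"] by (simp add: zero)
  then show False
    using m k by (simp add: integral_iff)
qed

lemma domain_P: "domain P"
proof (rule domain.intro[OF cring_P], unfold_locales)
  show "\<one>\<^bsub>P\<^esub> \<noteq> \<zero>\<^bsub>P\<^esub>"
    by (simp add: mpoly_ring_def)
next
  fix x y assume "x \<otimes>\<^bsub>P\<^esub> y = \<zero>\<^bsub>P\<^esub>" "x \<in> carrier P" "y \<in> carrier P"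
  then show "x = \<zero>\<^bsub>P\<^esub> \<or> y = \<zero>\<^bsub>P\<^esub>"
    using T_integral by (auto simp: carrier_P T_mult)
qed

end

sublocale coeff_cover \<subseteq> poly: domain_hom P T
  by (intro domain_hom.intro domain_hom_axioms.intro domain_P T_closed T_add T_mult T_one)

section \<open>Linear forms\<close>

definition linear_poly :: "nat \<Rightarrow> (nat \<Rightarrow> 'r) \<Rightarrow> nat multiset \<Rightarrow>\<^sub>0 'r::comm_ring_1" where
  "linear_poly l b = (\<Sum>i<l. single {#i#} (b i))"

lemma lookup_linear_poly_mult:
  "lookup (linear_poly l b * q) m = (\<Sum>i<l. if i \<in># m then b i * lookup q (m - {#i#}) else 0)"
  by (simp add: linear_poly_def sum_distrib_right lookup_sum lookup_single_add_times)

lemma lookup_linear_poly: "lookup (linear_poly l b) m = (\<Sum>i<l. if m = {#i#} then b i else 0)"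
  unfolding linear_poly_def lookup_sum by (intro sum.cong) (auto simp: lookup_single when_def)

context coeff_cover
begin

lemma coeff_map_linear_poly: "i < l \<Longrightarrow> T (linear_poly l b) {#i#} = h (b i)"
  by (simp add: coeff_map_def lookup_linear_poly)

lemma coeff_map_linear_poly_eq_zero: "(\<And>i. i < l \<Longrightarrow> m \<noteq> {#i#}) \<Longrightarrow> T (linear_poly l b) m = \<zero>"
  by (auto simp: coeff_map_def lookup_linear_poly H_zero)

lemma coeff_map_linear_poly_eqI:
  assumes "\<And>i. i < l \<Longrightarrow> h (b i) = f {#i#}" "\<And>m. (\<And>i. i < l \<Longrightarrow> m \<noteq> {#i#}) \<Longrightarrow> f m = \<zero>"
  shows "T (linear_poly l b) = f"
proof
  fix m show "T (linear_poly l b) m = f m"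
    using assms coeff_map_linear_poly coeff_map_linear_poly_eq_zero
    by (cases "\<exists>i<l. m = {#i#}") auto
qed

lemma linear_form_linear_poly:
  assumes "j < l" "h (b j) \<noteq> \<zero>"
  shows "linear_form K l (T (linear_poly l b))"
  unfolding linear_form_def
proof (intro conjI)
  show "homogeneous K 1 (T (linear_poly l b))"
    unfolding homogeneous_def
  proof (intro allI impI)
    fix m assume "T (linear_poly l b) m \<noteq> \<zero>"
    then obtain i where "m = {#i#}"
      using coeff_map_linear_poly_eq_zero[of m b] by blast
    then show "size m = 1" by simp
  qed
  show "T (linear_poly l b) \<noteq> \<zero>\<^bsub>P\<^esub>"
    using assms coeff_map_linear_poly[of j b] by (auto simp: mpoly_ring_def indexed_zero_def)
qed (rule T_closed)

lemma linear_form_imp_linear_poly: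
  assumes "linear_form K l \<beta>"
  obtains b where "\<beta> = T (linear_poly l b)" "\<exists>j<l. h (b j) \<noteq> \<zero>"
proof -
  obtain f where f: "\<beta> = T f" and hom: "\<And>m. T f m \<noteq> \<zero> \<Longrightarrow> size m = 1" and nz: "T f \<noteq> \<zero>\<^bsub>P\<^esub>"
    using assms by (auto simp: linear_form_def homogeneous_def carrier_P)
  define b where "b i = lookup f {#i#}" for i
  have var: "\<exists>i<l. m = {#i#}" if "T f m \<noteq> \<zero>" for m
  proof -
    have "size m = 1"
      using that by (rule hom)
    then obtain i where "m = {#i#}"
      using size_1_singleton_mset by blast
    then show ?thesis
      using that by (auto simp: coeff_map_def split: if_splits)
  qed
  have "T (linear_poly l b) = T f"
  proof (rule coeff_map_linear_poly_eqI)
    show "h (b i) = T f {#i#}" if "i < l" for i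
      using that by (simp add: b_def coeff_map_def)
    show "T f m = \<zero>" if "\<And>i. i < l \<Longrightarrow> m \<noteq> {#i#}" for m
      using var[of m] that by blast
  qed
  moreover obtain m where "T f m \<noteq> \<zero>"
    using nz by (auto simp: mpoly_ring_def indexed_zero_def)
  then have "\<exists>j<l. h (b j) \<noteq> \<zero>"
    using var[of m] by (auto simp: b_def coeff_map_def)
  ultimately show thesis
    by (intro that[of b]) (simp_all add: f)
qed

lemma mpoly_eval_linear_poly:
  assumes v: "v \<in> {..<l} \<rightarrow> carrier K"
  shows "mpoly_eval K l (T (linear_poly l b)) v = (\<Oplus>i\<in>{..<l}. h (b i) \<otimes> v i)"
proof -
  have prod: "(\<Otimes>j\<in>{..<l}. v j [^] count {#i#} j) = v i" if "i < l" for i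
  proof -
    have "(\<Otimes>j\<in>{..<l}. v j [^] count {#i#} j) = (\<Otimes>j\<in>{..<l}. if j = i then v j else \<one>)"
      using v that by (intro finprod_cong') (auto simp: Pi_iff)
    also have "\<dots> = v i"
      using v that by (intro finprod_singleton_swap) auto
    finally show ?thesis .
  qed
  have pow_closed: "(\<Otimes>j\<in>{..<l}. v j [^] count m j) \<in> carrier K" for m :: "nat multiset"
    using v by (intro finprod_closed) auto
  have "mpoly_eval K l (T (linear_poly l b)) v
      = (\<Oplus>m\<in>(\<lambda>i. {#i#}) ` {..<l}. T (linear_poly l b) m \<otimes> (\<Otimes>j\<in>{..<l}. v j [^] count m j))"
    unfolding mpoly_eval_def
  proof (rule add.finprod_mono_neutral_cong_left)
    show "{m. T (linear_poly l b) m \<noteq> \<zero>} \<subseteq> (\<lambda>i. {#i#}) ` {..<l}"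
      using coeff_map_linear_poly_eq_zero[of _ b] by blast
  qed (use pow_closed in auto)
  also have "\<dots> = (\<Oplus>i\<in>{..<l}. T (linear_poly l b) {#i#} \<otimes> (\<Otimes>j\<in>{..<l}. v j [^] count {#i#} j))"
    using pow_closed by (intro finsum_reindex) (auto simp: inj_on_def)
  also have "\<dots> = (\<Oplus>i\<in>{..<l}. h (b i) \<otimes> v i)"
  proof (rule finsum_cong')
    fix i assume "i \<in> {..<l}"
    then show "T (linear_poly l b) {#i#} \<otimes> (\<Otimes>j\<in>{..<l}. v j [^] count {#i#} j) = h (b i) \<otimes> v i"
      by (simp only: prod lessThan_iff coeff_map_linear_poly)
  qed (use v in auto)
  finally show ?thesis .
qed

lemma mpoly_deriv_linear_poly:
  assumes "i < l"
  shows "mpoly_deriv K i (T (linear_poly l b)) = T (single {#} (b i))"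
proof
  fix m
  show "mpoly_deriv K i (T (linear_poly l b)) m = T (single {#} (b i)) m"
  proof (cases "m = {#}")
    case True
    then show ?thesis
      using assms by (simp add: mpoly_deriv_def coeff_map_linear_poly coeff_map_const indexed_const_def)
  next
    case False
    then have "T (linear_poly l b) (add_mset i m) = \<zero>"
      by (intro coeff_map_linear_poly_eq_zero) auto
    with False show ?thesis
      by (simp add: mpoly_deriv_def coeff_map_const indexed_const_def)
  qed
qed

lemma der_apply_linear_poly:
  "der_apply K l (restrict (\<lambda>i. T (d i)) {..<l}) (T (linear_poly l b))
    = T (\<Sum>i<l. d i * single {#} (b i))"
proof -
  have "der_apply K l (restrict (\<lambda>i. T (d i)) {..<l}) (T (linear_poly l b))
      = (\<Oplus>\<^bsub>P\<^esub>i\<in>{..<l}. T (d i * single {#} (b i)))"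
    unfolding der_apply_def
    by (rule poly.finsum_cong') (auto simp: mpoly_deriv_linear_poly T_mult T_closed)
  also have "\<dots> = T (\<Sum>i<l. d i * single {#} (b i))"
    by (simp add: poly.H_sum)
  finally show ?thesis .
qed

text \<open>Every multiple of a linear form has constant coefficient zero.\<close>

lemma linear_poly_nonunit: "\<not> poly.hdvd (linear_poly l b) 1"
proof
  assume "poly.hdvd (linear_poly l b) 1"
  then obtain q where "T 1 = T (linear_poly l b * q)"
    unfolding poly.hdvd_def by blast
  then have "T 1 {#} = T (linear_poly l b * q) {#}"
    by simp
  then show False
    by (simp add: coeff_map_one indexed_const_def coeff_map_def lookup_linear_poly_mult H_zero H_one)
qed

text \<open>In degree one only the constant coefficient of the quotient contributes, and it is the
  factor of proportionality.\<close>

lemma linear_poly_hdvd_linear_poly: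
  assumes "poly.hdvd (linear_poly l b) (linear_poly l b')"
  obtains c where "\<And>i. i < l \<Longrightarrow> h (b' i) = h (c * b i)"
proof -
  obtain q where q: "T (linear_poly l b') = T (linear_poly l b * q)"
    using assms unfolding poly.hdvd_def by blast
  have "h (b' i) = h (lookup q {#} * b i)" if i: "i < l" for i
  proof -
    have "lookup (linear_poly l b * q) {#i#} = (\<Sum>j<l. if j = i then b j * lookup q {#} else 0)"
      unfolding lookup_linear_poly_mult by (intro sum.cong) auto
    also have "\<dots> = lookup q {#} * b i"
      using i by (simp add: mult.commute)
    finally have "lookup (linear_poly l b * q) {#i#} = lookup q {#} * b i" .
    then have "T (linear_poly l b * q) {#i#} = h (lookup q {#} * b i)"
      using i by (simp add: coeff_map_def)
    then show ?thesis
      using q i by (metis coeff_map_linear_poly)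
  qed
  then show thesis by (rule that)
qed

lemma zero_locus_subset:
  assumes c: "c \<in> carrier K" and eq: "\<And>i. i < l \<Longrightarrow> h (b' i) = c \<otimes> h (b i)"
  shows "zero_locus K l (T (linear_poly l b)) \<subseteq> zero_locus K l (T (linear_poly l b'))"
proof
  fix v assume "v \<in> zero_locus K l (T (linear_poly l b))"
  then have vE: "v \<in> {..<l} \<rightarrow>\<^sub>E carrier K" and zero: "mpoly_eval K l (T (linear_poly l b)) v = \<zero>"
    by (auto simp: zero_locus_def)
  have v: "v \<in> {..<l} \<rightarrow> carrier K"
    using vE by (auto simp: PiE_def)
  have "(\<Oplus>i\<in>{..<l}. h (b' i) \<otimes> v i) = (\<Oplus>i\<in>{..<l}. c \<otimes> (h (b i) \<otimes> v i))"
    using v c eq by (intro finsum_cong') (auto simp: m_assoc Pi_iff)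
  also have "\<dots> = c \<otimes> (\<Oplus>i\<in>{..<l}. h (b i) \<otimes> v i)"
    using v c by (intro finsum_rdistr[symmetric]) (auto simp: Pi_iff)
  also have "\<dots> = \<zero>"
    using zero c by (simp add: mpoly_eval_linear_poly[OF v])
  finally show "v \<in> zero_locus K l (T (linear_poly l b'))"
    using vE by (simp add: zero_locus_def mpoly_eval_linear_poly[OF v])
qed

text \<open>The vectors \<open>b j e\<^sub>i - b i e\<^sub>j\<close> of the first hyperplane determine the second equation.\<close>

lemma zero_locus_subset_imp:
  assumes sub: "zero_locus K l (T (linear_poly l b)) \<subseteq> zero_locus K l (T (linear_poly l b'))"
    and i: "i < l" and j: "j < l"
  shows "h (b j * b' i) = h (b i * b' j)"
proof (cases "i = j")
  case False
  define w where "w t = (if t = i then b j else if t = j then - b i else 0)" for t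
  define v where "v = restrict (\<lambda>t. h (w t)) {..<l}"
  have v: "v \<in> {..<l} \<rightarrow> carrier K" "v \<in> {..<l} \<rightarrow>\<^sub>E carrier K"
    by (auto simp: v_def)
  have eval: "mpoly_eval K l (T (linear_poly l g)) v = h (g i * b j - g j * b i)" for g
  proof -
    have "mpoly_eval K l (T (linear_poly l g)) v = (\<Oplus>t\<in>{..<l}. h (g t * w t))"
      unfolding mpoly_eval_linear_poly[OF v(1)]
      by (rule finsum_cong') (auto simp: v_def H_mult)
    also have "\<dots> = h (\<Sum>t<l. g t * w t)"
      by (simp add: H_sum)
    also have "(\<Sum>t<l. g t * w t) = (\<Sum>t\<in>{i,j}. g t * w t)"
      by (rule sum.mono_neutral_right) (use i j in \<open>auto simp: w_def\<close>)
    also have "\<dots> = g i * b j - g j * b i"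
      using False by (simp add: w_def)
    finally show ?thesis .
  qed
  have "v \<in> zero_locus K l (T (linear_poly l b))"
    using v(2) by (simp add: zero_locus_def eval mult.commute H_zero)
  then have "h (b' i * b j - b' j * b i) = \<zero>"
    using sub by (auto simp: zero_locus_def eval)
  then have "h (b' i * b j - b' j * b i + b' j * b i) = h (b' j * b i)"
    unfolding H_add[of "b' i * b j - b' j * b i"] by simp
  then show ?thesis
    by (simp add: mult.commute)
qed (simp add: mult.commute)

subsection \<open>Linear forms are prime\<close>

lemma index_free_add: "index_free (T r) j \<Longrightarrow> index_free (T s) j \<Longrightarrow> index_free (T (r + s)) j"
  by (auto simp: index_free_def coeff_map_add indexed_padd_def)

lemma index_free_mult:
  assumes "index_free (T r) j" "index_free (T s) j"
  shows "index_free (T (r * s)) j"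
  unfolding index_free_def coeff_map_mult mpoly_mult_def
proof (intro allI impI, rule add.finprod_one_eqI)
  fix m a assume "j \<in># m" "a \<in> {a. a \<subseteq># m}"
  then have "j \<in># a + (m - a)"
    by simp
  then have "j \<in># a \<or> j \<in># m - a"
    by (simp only: union_iff)
  then show "T r a \<otimes> T s (m - a) = \<zero>"
    using assms by (auto simp: index_free_def)
qed

text \<open>Modulo the form, x_j is a combination of the other variables because its coefficient is
  invertible. Polynomials without x_j are closed under sums and products, so the substitution
  extends from the generators.\<close>

lemma exists_remainder:
  assumes j: "j < l" and u: "h (b j * u) = \<one>"
  shows "\<exists>q r. T f = T (linear_poly l b * q + r) \<and> index_free (T r) j"
proof (induction f rule: poly_mapping_induct_ring)
  case (const c)
  show ?case
    by (intro exI[of _ 0] exI[of _ "single {#} c"])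
      (auto simp: coeff_map_const indexed_const_index_free)
next
  case (var i)
  show ?case
  proof (cases "i = j")
    case False
    have "index_free (T (single {#i#} 1)) j"
      using False by (auto simp: index_free_def coeff_map_def lookup_single when_def H_zero)
    then show ?thesis
      by (intro exI[of _ 0] exI[of _ "single {#i#} 1"]) auto
  next
    case True
    \<comment> \<open>This is x_j minus \<open>u\<close> times the linear form: the
      \<open>j\<close>-th term cancels since \<open>b j * u\<close> maps to one.\<close>
    define r where "r = - linear_poly l (\<lambda>t. if t = j then 0 else b t * u)"
    have "index_free (T r) j"
      unfolding index_free_def
    proof (intro allI impI)
      fix m assume "j \<in># m"
      then have "lookup r m = 0"
        unfolding r_def by (auto simp: lookup_linear_poly intro!: sum.neutral)
      then show "T r m = \<zero>"
        by (simp add: coeff_map_def H_zero)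
    qed
    moreover have "T (single {#i#} 1) = T (linear_poly l b * single {#} u + r)"
    proof -
      have "linear_poly l b * single {#} u + r = (\<Sum>t<l. if t = j then single {#t#} (b t * u) else 0)"
        unfolding r_def linear_poly_def sum_distrib_right sum_negf[symmetric] sum.distrib[symmetric]
        by (intro sum.cong) (auto simp: mult_single)
      also have "\<dots> = single {#j#} (b j * u)"
        using j by simp
      finally show ?thesis
        using True u by (auto simp: coeff_map_def lookup_single H_zero H_one when_def fun_eq_iff)
    qed
    ultimately show ?thesis by blast
  qed
next
  case (add f g)
  then obtain q r q' r' where "T f = T (linear_poly l b * q + r)" "index_free (T r) j"
    "T g = T (linear_poly l b * q' + r')" "index_free (T r') j"
    by blast
  then have "T (f + g) = T (linear_poly l b * (q + q') + (r + r'))"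
    by (simp add: coeff_map_add[of f] coeff_map_add[symmetric] algebra_simps)
  then show ?case
    using index_free_add \<open>index_free (T r) j\<close> \<open>index_free (T r') j\<close> by blast
next
  case (mult f g)
  then obtain q r q' r' where "T f = T (linear_poly l b * q + r)" "index_free (T r) j"
    "T g = T (linear_poly l b * q' + r')" "index_free (T r') j"
    by blast
  then have "T (f * g) = T (linear_poly l b * (q * (linear_poly l b * q' + r') + r * q') + r * r')"
    by (simp add: coeff_map_mult[of f] coeff_map_mult[symmetric] algebra_simps)
  then show ?case
    using index_free_mult \<open>index_free (T r) j\<close> \<open>index_free (T r') j\<close> by blast
qed

text \<open>
  If \<open>q\<close> is nonzero, a monomial of \<open>q\<close> with maximal exponent of \<open>x\<^sub>j\<close> contributes a monomial to
  the product with a linear form containing \<open>x\<^sub>j\<close>, and nothing cancels it.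
\<close>

lemma index_free_linear_poly_mult:
  assumes j: "j < l" and b: "h (b j) \<noteq> \<zero>" and free: "index_free (T (linear_poly l b * q)) j"
  shows "T q = \<zero>\<^bsub>P\<^esub>"
proof (rule ccontr)
  assume "T q \<noteq> \<zero>\<^bsub>P\<^esub>"
  then have "{m. T q m \<noteq> \<zero>} \<noteq> {}"
    by (auto simp: mpoly_ring_def indexed_zero_def)
  then have "Max ((\<lambda>m. count m j) ` {m. T q m \<noteq> \<zero>}) \<in> (\<lambda>m. count m j) ` {m. T q m \<noteq> \<zero>}"
    using finite_coeff_map_support by (intro Max_in) auto
  then obtain m where m: "T q m \<noteq> \<zero>"
    and "count m j = Max ((\<lambda>m. count m j) ` {m. T q m \<noteq> \<zero>})"
    by auto
  then have max: "count m' j \<le> count m j" if "T q m' \<noteq> \<zero>" for m'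
    using that finite_coeff_map_support by simp
  have vars: "set_mset m \<subseteq> {..<l}"
    using m by (auto simp: coeff_map_def split: if_splits)
  have "h (lookup (linear_poly l b * q) (add_mset j m)) = h (\<Sum>i<l. if i = j then b j * lookup q m else 0)"
    unfolding lookup_linear_poly_mult
  proof (rule H_sum_cong)
    fix i assume "i \<in> {..<l}"
    show "h (if i \<in># add_mset j m then b i * lookup q (add_mset j m - {#i#}) else 0)
        = h (if i = j then b j * lookup q m else 0)"
    proof (cases "i = j \<or> i \<notin># m")
      case True
      then show ?thesis by auto
    next
      case False
      \<comment> \<open>A variable other than x_j is removed, so the remaining monomial exceeds the
        maximal exponent and has coefficient zero in \<open>q\<close>.\<close>
      then have "count (add_mset j m - {#i#}) j > count m j"
        by simp
      then have "T q (add_mset j m - {#i#}) = \<zero>"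
        using max by (meson linorder_not_less)
      moreover have "set_mset (add_mset j m - {#i#}) \<subseteq> {..<l}"
        using vars j by (auto dest!: in_diffD)
      ultimately have "h (lookup q (add_mset j m - {#i#})) = \<zero>"
        by (simp add: coeff_map_def)
      then show ?thesis
        using False by (simp add: H_mult H_zero)
    qed
  qed
  also have "\<dots> = h (b j) \<otimes> T q m"
    using j vars by (simp add: H_mult coeff_map_def)
  also have "\<dots> \<noteq> \<zero>"
    using b m by (simp add: integral_iff)
  finally have "T (linear_poly l b * q) (add_mset j m) \<noteq> \<zero>"
    using vars j by (simp add: coeff_map_def)
  then show False
    using free by (auto simp: index_free_def)
qed

text \<open>The quotient by the form is in effect the domain of polynomials without x_j. If the form
  divides the product, the product of the remainders is a multiple of it that avoids x_j, hence
  zero, and one remainder vanishes.\<close>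

lemma linear_poly_prime:
  assumes j: "j < l" and u: "h (b j * u) = \<one>" and dvd: "poly.hdvd (linear_poly l b) (x * y)"
  shows "poly.hdvd (linear_poly l b) x \<or> poly.hdvd (linear_poly l b) y"
proof -
  let ?L = "linear_poly l b"
  have bj: "h (b j) \<noteq> \<zero>"
    using u by (auto simp: H_mult)
  obtain q r where x: "T x = T (?L * q + r)" and r: "index_free (T r) j"
    using exists_remainder[of j b u x, OF j u] by blast
  obtain q' r' where y: "T y = T (?L * q' + r')" and r': "index_free (T r') j"
    using exists_remainder[of j b u y, OF j u] by blast
  obtain p where p: "T (x * y) = T (?L * p)"
    using dvd unfolding poly.hdvd_def by blast
  have "T (x * y) = T (?L * (q * (?L * q' + r') + r * q') + r * r')"
    using x y by (simp add: coeff_map_mult[of x] coeff_map_mult[symmetric] algebra_simps)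
  then have "T (?L * p - ?L * (q * (?L * q' + r') + r * q')) = T (r * r')"
    by (intro poly.H_diff_eqI) (simp only: p[symmetric])
  then have eq: "T (?L * (p - (q * (?L * q' + r') + r * q'))) = T (r * r')"
    by (simp only: right_diff_distrib)
  then have "T (p - (q * (?L * q' + r') + r * q')) = \<zero>\<^bsub>P\<^esub>"
    using index_free_mult[OF r r'] by (intro index_free_linear_poly_mult[of j b, OF j bj]) simp
  then have "T (r * r') = T (?L * 0)"
    unfolding eq[symmetric] T_mult[of ?L] by (simp only: T_zero)
  then have "T (r * r') = \<zero>\<^bsub>P\<^esub>"
    by (simp add: T_zero)
  then have rr': "T r = T 0 \<or> T r' = T 0"
    using T_integral[of r r'] by (auto simp: T_zero)
  have xq: "T x = T (?L * q)" if "T r = T 0"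
    unfolding x T_add that by (simp only: T_add[symmetric] add_0_right)
  have yq: "T y = T (?L * q')" if "T r' = T 0"
    unfolding y T_add that by (simp only: T_add[symmetric] add_0_right)
  show ?thesis
    using rr' poly.hdvdI[OF xq] poly.hdvdI[OF yq] by argo
qed

end

section \<open>Free arrangements and determinants\<close>

text \<open>The condition \<open>not_hdvd\<close> says that the hyperplanes are distinct, in terms
  of equations rather than zero loci, because divisibility is what square-freeness modulo
  \<open>p\<close> controls.\<close>

locale linear_arrangement = coeff_cover K h l + field K
  for K :: "('a, 'm) ring_scheme" (structure) and h :: "'r::comm_ring_1 \<Rightarrow> 'a" and l +
  fixes n :: nat and b :: "nat \<Rightarrow> nat \<Rightarrow> 'r"
  assumes nonzero_coeff: "k < n \<Longrightarrow> \<exists>j<l. h (b k j) \<noteq> \<zero>"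
    and not_hdvd: "k < n \<Longrightarrow> k' < n \<Longrightarrow> k \<noteq> k' \<Longrightarrow>
      \<not> poly.hdvd (linear_poly l (b k)) (linear_poly l (b k'))"
begin

lemma exists_inverse:
  assumes "h x \<noteq> \<zero>"
  shows "\<exists>u. h (x * u) = \<one>"
proof -
  have "inv (h x) \<in> carrier K" "h x \<otimes> inv (h x) = \<one>"
    using assms by (auto simp: field_Units)
  moreover obtain u where "inv (h x) = h u"
    using surj calculation(1) by blast
  ultimately show ?thesis
    by (metis H_mult)
qed

end

sublocale linear_arrangement \<subseteq>
  saito P T l n "\<lambda>k. linear_poly l (b k)" "\<lambda>k j. single {#} (b k j)"
proof unfold_locales
  fix k assume k: "k < n"
  obtain j where j: "j < l" "h (b k j) \<noteq> \<zero>"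
    using nonzero_coeff[OF k] by blast
  obtain u where u: "h (b k j * u) = \<one>"
    using exists_inverse[OF j(2)] by blast
  have "T (single {#} (b k j) * single {#} u) = \<one>\<^bsub>P\<^esub>"
    using u by (simp add: mult_single coeff_map_const mpoly_ring_def)
  then show "\<exists>j<l. \<exists>u. T (single {#} (b k j) * u) = \<one>\<^bsub>P\<^esub>"
    using j by blast
  show "poly.hdvd (linear_poly l (b k)) x \<or> poly.hdvd (linear_poly l (b k)) y"
    if "poly.hdvd (linear_poly l (b k)) (x * y)" for x y
    using linear_poly_prime[of j "b k" u, OF j(1) u that] .
  show "\<not> poly.hdvd (linear_poly l (b k)) 1"
    by (rule linear_poly_nonunit)
  show "T (linear_poly l (b k)) \<noteq> \<zero>\<^bsub>P\<^esub>"
    using linear_form_linear_poly[of j "b k", OF j] by (simp add: linear_form_def)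
qed (rule not_hdvd)

context linear_arrangement
begin

section \<open>The module of logarithmic derivations\<close>

abbreviation arrangement where
  "arrangement \<equiv> (\<lambda>k. zero_locus K l (T (linear_poly l (b k)))) ` {..<n}"

abbreviation LD where "LD \<equiv> log_der K l arrangement"

text \<open>The restriction produces the extensional functions that make up the carrier of
  \<open>Der\<close>.\<close>

definition derivation :: "(nat \<Rightarrow> nat multiset \<Rightarrow>\<^sub>0 'r) \<Rightarrow> nat \<Rightarrow> nat multiset \<Rightarrow> 'a" where
  "derivation d = restrict (\<lambda>j. T (d j)) {..<l}"

lemma derivation_apply [simp]: "j < l \<Longrightarrow> derivation d j = T (d j)"
  by (simp add: derivation_def)

lemma derivation_eq_iff: "derivation d = derivation d' \<longleftrightarrow> (\<forall>j<l. T (d j) = T (d' j))"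
  by (auto simp: derivation_def restrict_def fun_eq_iff)

lemma carrier_Der: "carrier (Der K l) = range derivation"
proof (intro equalityI subsetI)
  fix \<delta> assume "\<delta> \<in> carrier (Der K l)"
  then have \<delta>: "\<delta> \<in> {..<l} \<rightarrow>\<^sub>E range T"
    by (simp add: Der_def poly.func_space_def carrier_P)
  then have "\<forall>j\<in>{..<l}. \<exists>f. \<delta> j = T f"
    by (auto simp: PiE_def Pi_def)
  then obtain d where "\<forall>j\<in>{..<l}. \<delta> j = T (d j)"
    by metis
  then have "\<delta> = derivation d"
    using \<delta> by (auto simp: derivation_def fun_eq_iff PiE_def extensional_def)
  then show "\<delta> \<in> range derivation" by blast
qed (auto simp: Der_def poly.func_space_def derivation_def T_closed)

lemma PIdl_iff: "T f \<in> PIdl\<^bsub>P\<^esub> (T g) \<longleftrightarrow> poly.hdvd g f"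
proof -
  have "T f \<in> PIdl\<^bsub>P\<^esub> (T g) \<longleftrightarrow> (\<exists>q. T f = T q \<otimes>\<^bsub>P\<^esub> T g)"
    unfolding cgenideal_def carrier_P by auto
  then show ?thesis
    by (simp only: poly.hdvd_def T_mult[symmetric] mult.commute[of g])
qed

text \<open>The carrier imposes its condition for every equation of a hyperplane. Two equations with
  the same zero locus are proportional, so the condition for the chosen one carries over.\<close>

lemma derivation_in_log_der_iff: "derivation d \<in> carrier LD \<longleftrightarrow> logarithmic d"
proof
  assume D: "derivation d \<in> carrier LD"
  show "logarithmic d"
    unfolding logarithmic_def
  proof (intro allI impI)
    fix k assume k: "k < n"
    obtain j where j: "j < l" "h (b k j) \<noteq> \<zero>"
      using nonzero_coeff[OF k] by blast
    have "der_apply K l (derivation d) (T (linear_poly l (b k))) \<in> PIdl\<^bsub>P\<^esub> (T (linear_poly l (b k)))"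
      using D k linear_form_linear_poly[of j "b k", OF j] by (simp add: log_der_def)
    then show "poly.hdvd (linear_poly l (b k)) (\<Sum>j<l. d j * single {#} (b k j))"
      by (simp only: derivation_def der_apply_linear_poly PIdl_iff)
  qed
next
  assume d: "logarithmic d"
  have "der_apply K l (derivation d) \<beta> \<in> PIdl\<^bsub>P\<^esub> \<beta>"
    if k: "k < n" and \<beta>: "linear_form K l \<beta>"
      and eq: "zero_locus K l (T (linear_poly l (b k))) = zero_locus K l \<beta>" for k \<beta>
  proof -
    obtain b' where b': "\<beta> = T (linear_poly l b')"
      using \<beta> by (rule linear_form_imp_linear_poly)
    obtain j where j: "j < l" "h (b k j) \<noteq> \<zero>"
      using nonzero_coeff[OF k] by blast
    obtain u where u: "h (b k j * u) = \<one>"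
      using exists_inverse[OF j(2)] by blast
    \<comment> \<open>The factor between the two equations is read off at the index
      \<open>j\<close>, where \<open>b k j\<close> has inverse \<open>u\<close>.\<close>
    have ratio: "h (b' i) = h (u * b' j * b k i)" if "i < l" for i
    proof -
      have "h (b k j * b' i) = h (b k i * b' j)"
        using zero_locus_subset_imp[of "b k" b' i j] eq b' that j by simp
      then have "h (u * (b k j * b' i)) = h (u * (b k i * b' j))"
        by (simp only: H_mult[of u])
      moreover have "h (u * (b k j * b' i)) = h (b k j * u) \<otimes> h (b' i)"
        by (simp add: H_mult m_ac)
      ultimately have "h (b' i) = h (u * (b k i * b' j))"
        by (simp only: u l_one H_closed)
      then show ?thesis
        by (simp only: mult_ac)
    qed
    let ?c = "single {#} (u * b' j)"
    have L: "T (linear_poly l b') = T (?c * linear_poly l (b k))"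
      unfolding linear_poly_def sum_distrib_left
      by (rule poly.H_sum_cong) (auto simp: mult_single coeff_map_def lookup_single when_def ratio H_zero)
    obtain q where q: "T (\<Sum>j<l. d j * single {#} (b k j)) = T (linear_poly l (b k) * q)"
      using d k unfolding logarithmic_def poly.hdvd_def by blast
    have "T (\<Sum>j<l. d j * single {#} (b' j)) = T (?c * (\<Sum>j<l. d j * single {#} (b k j)))"
      unfolding sum_distrib_left
    proof (rule poly.H_sum_cong)
      fix i assume "i \<in> {..<l}"
      then have "T (single {#} (b' i)) = T (?c * single {#} (b k i))"
        by (simp add: mult_single coeff_map_const ratio)
      then have "T (d i * single {#} (b' i)) = T (d i * (?c * single {#} (b k i)))"
        by (simp add: T_mult[of "d i"])
      then show "T (d i * single {#} (b' i)) = T (?c * (d i * single {#} (b k i)))"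
        by (simp add: mult.left_commute)
    qed
    also have "\<dots> = T (?c * (linear_poly l (b k) * q))"
      using q by (simp add: T_mult[of ?c])
    also have "\<dots> = T (linear_poly l b' * q)"
      unfolding mult.assoc[symmetric] T_mult[of _ q] L ..
    finally have "poly.hdvd (linear_poly l b') (\<Sum>j<l. d j * single {#} (b' j))"
      by (rule poly.hdvdI)
    then show ?thesis
      unfolding b' derivation_def der_apply_linear_poly PIdl_iff .
  qed
  then show "derivation d \<in> carrier LD"
    by (auto simp: log_der_def carrier_Der)
qed

lemma carrier_log_der: "carrier LD = derivation ` Collect logarithmic"
proof (intro equalityI subsetI)
  fix \<delta> assume \<delta>: "\<delta> \<in> carrier LD"
  then have "\<delta> \<in> carrier (Der K l)"
    by (simp add: log_der_def)
  then obtain d where "\<delta> = derivation d"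
    by (auto simp: carrier_Der)
  with \<delta> show "\<delta> \<in> derivation ` Collect logarithmic"
    using derivation_in_log_der_iff by blast
qed (auto simp: derivation_in_log_der_iff)

lemma log_der_add: "derivation d \<oplus>\<^bsub>LD\<^esub> derivation d' = derivation (\<lambda>j. d j + d' j)"
  by (auto simp: log_der_def Der_def poly.func_space_def derivation_def T_add)

lemma log_der_zero: "\<zero>\<^bsub>LD\<^esub> = derivation (\<lambda>j. 0)"
  by (auto simp: log_der_def Der_def poly.func_space_def derivation_def T_zero)

lemma log_der_smult: "T f \<odot>\<^bsub>LD\<^esub> derivation d = derivation (\<lambda>j. f * d j)"
  by (auto simp: log_der_def Der_def poly.func_space_def derivation_def T_mult)

lemma module_log_der: "Module.module P LD"
proof -
  interpret D: Module.module P "Der K l"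
    unfolding Der_def by (rule poly.func_space_is_module)
  have ops: "x \<oplus>\<^bsub>Der K l\<^esub> y = x \<oplus>\<^bsub>LD\<^esub> y" "\<zero>\<^bsub>Der K l\<^esub> = \<zero>\<^bsub>LD\<^esub>" "c \<odot>\<^bsub>Der K l\<^esub> x = c \<odot>\<^bsub>LD\<^esub> x" for x y c
    by (simp_all add: log_der_def)
  have "submodule P (carrier LD) (Der K l)"
  proof
    show "carrier LD \<subseteq> carrier (Der K l)"
      by (auto simp: carrier_log_der carrier_Der)
  qed (auto simp: ops carrier_log_der log_der_add log_der_zero log_der_smult carrier_P
      intro: logarithmic_add logarithmic_zero logarithmic_mult)
  from D.submodule_is_module[OF this] show ?thesis
    by (simp add: log_der_def)
qed

lemma finsum_log_der:
  assumes "finite A" "\<And>i. i \<in> A \<Longrightarrow> logarithmic (d i)"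
  shows "(\<Oplus>\<^bsub>LD\<^esub>i\<in>A. derivation (d i)) = derivation (\<lambda>j. \<Sum>i\<in>A. d i j)"
proof -
  interpret M: Module.module P LD by (rule module_log_der)
  show ?thesis
    using assms
  proof (induction A rule: finite_induct)
    case (insert i A)
    then have "(\<Oplus>\<^bsub>LD\<^esub>i\<in>insert i A. derivation (d i))
        = derivation (d i) \<oplus>\<^bsub>LD\<^esub> (\<Oplus>\<^bsub>LD\<^esub>i\<in>A. derivation (d i))"
      by (intro M.finsum_insert) (auto simp: derivation_in_log_der_iff)
    with insert show ?case
      by (simp add: log_der_add)
  qed (simp add: log_der_zero)
qed

text \<open>Linear combinations attach coefficients to vectors of a set; injectivity turns them into
  sums over indices, which are the rows of a matrix.\<close>

lemma lincomb_log_der: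
  assumes "\<And>i. i < l \<Longrightarrow> logarithmic (d i)" "inj_on (\<lambda>i. derivation (d i)) {..<l}"
    and "\<And>i. i < l \<Longrightarrow> c (derivation (d i)) = T (f i)"
  shows "LinearCombinations.module.lincomb LD c ((\<lambda>i. derivation (d i)) ` {..<l})
    = derivation (\<lambda>j. \<Sum>i<l. f i * d i j)"
proof -
  interpret M: Module.module P LD by (rule module_log_der)
  have summand: "c (derivation (d i)) \<odot>\<^bsub>LD\<^esub> derivation (d i) = derivation (\<lambda>j. f i * d i j)" if "i < l" for i
    using assms that by (simp add: log_der_smult)
  have log: "logarithmic (\<lambda>j. f i * d i j)" if "i < l" for i
    using assms that by (intro logarithmic_mult)
  have "M.lincomb c ((\<lambda>i. derivation (d i)) ` {..<l})
      = (\<Oplus>\<^bsub>LD\<^esub>i\<in>{..<l}. c (derivation (d i)) \<odot>\<^bsub>LD\<^esub> derivation (d i))"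
    unfolding M.lincomb_def
    by (rule M.finsum_reindex) (use assms summand log in \<open>auto simp: derivation_in_log_der_iff\<close>)
  also have "\<dots> = (\<Oplus>\<^bsub>LD\<^esub>i\<in>{..<l}. derivation (\<lambda>j. f i * d i j))"
    by (rule M.finsum_cong') (use summand log in \<open>auto simp: derivation_in_log_der_iff\<close>)
  also have "\<dots> = derivation (\<lambda>j. \<Sum>i<l. f i * d i j)"
    by (rule finsum_log_der) (use log in auto)
  finally show ?thesis .
qed

section \<open>Bases and determinants\<close>

text \<open>The rows of \<open>M\<close> are representatives of the basis derivations, and spanning
  is read as the hypothesis of \<open>saito_det\<close>.\<close>

theorem free_imp_det:
  assumes "free_with_exponents K l arrangement e"
  obtains M c c' where "log_rows M" "T (det M) = T (c * Q)" "T (c * c') = \<one>\<^bsub>P\<^esub>"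
    "\<And>i j. i < l \<Longrightarrow> j < l \<Longrightarrow> homogeneous K (e i) (T (M $$ (i,j)))"
proof -
  interpret M: Module.module P LD by (rule module_log_der)
  obtain \<delta> where \<delta>: "\<delta> ` {..<l} \<subseteq> carrier LD" and inj: "inj_on \<delta> {..<l}"
    and span: "M.span (\<delta> ` {..<l}) = carrier LD" and pdeg: "\<And>i. i < l \<Longrightarrow> has_pdeg K l (\<delta> i) (e i)"
    using assms unfolding free_with_exponents_def indexed_basis_def by blast
  have "\<forall>i\<in>{..<l}. \<exists>d. \<delta> i = derivation d \<and> logarithmic d"
    using \<delta> by (auto simp: carrier_log_der)
  then obtain d where d: "\<And>i. i < l \<Longrightarrow> \<delta> i = derivation (d i)" "\<And>i. i < l \<Longrightarrow> logarithmic (d i)"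
    by (metis lessThan_iff)
  have image: "\<delta> ` {..<l} = (\<lambda>i. derivation (d i)) ` {..<l}"
    using d(1) by (intro image_cong) auto
  have inj': "inj_on (\<lambda>i. derivation (d i)) {..<l}"
    using inj d(1) by (simp add: inj_on_def)
  define N where "N = mat l l (\<lambda>(i,j). d i j)"
  have N: "log_rows N"
    unfolding log_rows_def
  proof (intro conjI allI impI)
    fix i assume i: "i < l"
    have "(\<Sum>j<l. N $$ (i,j) * a j) = (\<Sum>j<l. d i j * a j)" for a
      using i by (intro sum.cong) (auto simp: N_def)
    then show "logarithmic (\<lambda>j. N $$ (i,j))"
      using d(2)[OF i] by (simp add: logarithmic_def)
  qed (simp add: N_def)
  have "\<exists>c c'. T (det N) = T (c * Q) \<and> T (c * c') = \<one>\<^bsub>P\<^esub>"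
  proof (rule saito_det[OF N])
    fix \<eta> assume "logarithmic \<eta>"
    then have "derivation \<eta> \<in> M.span (\<delta> ` {..<l})"
      by (simp add: span derivation_in_log_der_iff)
    then obtain c where c: "c \<in> \<delta> ` {..<l} \<rightarrow> carrier P" "M.lincomb c (\<delta> ` {..<l}) = derivation \<eta>"
      using M.finite_in_span[OF _ \<delta>] by blast
    have "\<forall>i\<in>{..<l}. \<exists>f. c (derivation (d i)) = T f"
      using c(1) d(1) by (auto simp: carrier_P Pi_def)
    then obtain f where f: "\<And>i. i < l \<Longrightarrow> c (derivation (d i)) = T (f i)"
      by (metis lessThan_iff)
    have "derivation \<eta> = derivation (\<lambda>j. \<Sum>i<l. f i * d i j)"
      using c(2) lincomb_log_der[of d c f, OF d(2) inj' f] by (simp add: image)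
    then have "T (\<eta> j) = T (\<Sum>i<l. f i * N $$ (i,j))" if "j < l" for j
      using that by (simp add: derivation_eq_iff N_def)
    then show "\<exists>f. \<forall>j<l. T (\<eta> j) = T (\<Sum>i<l. f i * N $$ (i,j))"
      by blast
  qed
  moreover have "homogeneous K (e i) (T (N $$ (i,j)))" if "i < l" "j < l" for i j
    using pdeg[OF that(1)] that d(1)[OF that(1)] by (simp add: has_pdeg_def N_def)
  ultimately show thesis
    using that[OF N] by blast
qed

theorem det_imp_free:
  assumes M: "log_rows M" and det: "T (det M) = T (c * Q)" and unit: "T (c * c') = \<one>\<^bsub>P\<^esub>"
    and hom: "\<And>i j. i < l \<Longrightarrow> j < l \<Longrightarrow> homogeneous K (e i) (T (M $$ (i,j)))"
  shows "free_with_exponents K l arrangement e"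
proof -
  interpret M: Module.module P LD by (rule module_log_der)
  define d where "d i j = M $$ (i,j)" for i j
  have Mc: "M \<in> carrier_mat l l" and log: "\<And>i. i < l \<Longrightarrow> logarithmic (d i)"
    using M by (auto simp: log_rows_def d_def[abs_def])
  have indep: "T (f i) = \<zero>\<^bsub>P\<^esub>" if "\<And>j. j < l \<Longrightarrow> T (\<Sum>i<l. f i * d i j) = T 0" "i < l" for f i
    by (rule saito_independent[OF Mc det unit]) (use that in \<open>auto simp: d_def T_zero\<close>)
  let ?\<delta> = "\<lambda>i. derivation (d i)"
  have carrier: "?\<delta> ` {..<l} \<subseteq> carrier LD"
    using log by (auto simp: derivation_in_log_der_iff)
  have inj: "inj_on ?\<delta> {..<l}"
  proof (rule inj_onI, rule ccontr)
    fix i i' assume i: "i \<in> {..<l}" "i' \<in> {..<l}" "?\<delta> i = ?\<delta> i'" "i \<noteq> i'"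
    \<comment> \<open>Equal derivations at different indices would be a relation between rows with
      coefficients 1 and -1.\<close>
    define f :: "nat \<Rightarrow> nat multiset \<Rightarrow>\<^sub>0 'r" where "f r = (if r = i then 1 else if r = i' then - 1 else 0)" for r
    have "T (\<Sum>r<l. f r * d r j) = T 0" if j: "j < l" for j
    proof -
      have "(\<Sum>r<l. f r * d r j) = (\<Sum>r\<in>{i,i'}. f r * d r j)"
        by (rule sum.mono_neutral_right) (use i in \<open>auto simp: f_def\<close>)
      also have "\<dots> = d i j - d i' j"
        using i by (simp add: f_def)
      finally show ?thesis
        using i(3) j by (simp only: derivation_eq_iff) (rule poly.H_diff_eqI, simp)
    qed
    then have "T (f i) = \<zero>\<^bsub>P\<^esub>"
      using i by (intro indep) auto
    then show False
      by (simp add: f_def T_one)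
  qed
  have lincomb: "\<exists>f. (\<forall>i<l. c (?\<delta> i) = T (f i)) \<and>
      M.lincomb c (?\<delta> ` {..<l}) = derivation (\<lambda>j. \<Sum>i<l. f i * d i j)"
    if "c \<in> ?\<delta> ` {..<l} \<rightarrow> carrier P" for c
  proof -
    have "\<forall>i\<in>{..<l}. \<exists>f. c (?\<delta> i) = T f"
      using that by (auto simp: carrier_P Pi_def)
    then obtain f where f: "\<And>i. i < l \<Longrightarrow> c (?\<delta> i) = T (f i)"
      by (metis lessThan_iff)
    then show ?thesis
      using lincomb_log_der[of d c f, OF log inj f] by blast
  qed
  have "\<not> M.lin_dep (?\<delta> ` {..<l})"
  proof (rule M.finite_lin_indpt2[OF _ carrier])
    fix c assume "c \<in> ?\<delta> ` {..<l} \<rightarrow> carrier P" and zero: "M.lincomb c (?\<delta> ` {..<l}) = \<zero>\<^bsub>LD\<^esub>"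
    then obtain f where f: "\<forall>i<l. c (?\<delta> i) = T (f i)"
      and "M.lincomb c (?\<delta> ` {..<l}) = derivation (\<lambda>j. \<Sum>i<l. f i * d i j)"
      using lincomb by blast
    with zero have "\<forall>j<l. T (\<Sum>i<l. f i * d i j) = T 0"
      by (simp add: log_der_zero derivation_eq_iff)
    then show "\<forall>v\<in>?\<delta> ` {..<l}. c v = \<zero>\<^bsub>P\<^esub>"
      using f indep by auto
  qed simp
  moreover have "M.span (?\<delta> ` {..<l}) = carrier LD"
  proof (intro equalityI subsetI)
    fix v assume "v \<in> M.span (?\<delta> ` {..<l})"
    then show "v \<in> carrier LD"
      using M.finite_in_span[OF _ carrier] carrier M.lincomb_closed by blast
  next
    fix v assume "v \<in> carrier LD"
    then obtain \<eta> where \<eta>: "logarithmic \<eta>" "v = derivation \<eta>"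
      by (auto simp: carrier_log_der)
    obtain f where f: "\<forall>j<l. T (\<eta> j) = T (\<Sum>i<l. f i * d i j)"
      using saito_spanning[OF M \<eta>(1) det unit] by (auto simp: d_def)
    \<comment> \<open>Coefficients must depend on the vector, so its index is recovered by
      injectivity.\<close>
    define c where "c v = T (f (the_inv_into {..<l} ?\<delta> v))" for v
    have c: "c (?\<delta> i) = T (f i)" if "i < l" for i
      using that the_inv_into_f_f[OF inj, of i] by (simp add: c_def)
    have "v = M.lincomb c (?\<delta> ` {..<l})"
      using f by (simp add: \<eta> lincomb_log_der[of d c f, OF log inj c] derivation_eq_iff)
    moreover have "c \<in> ?\<delta> ` {..<l} \<rightarrow> carrier P"
      by (simp add: c_def T_closed)
    ultimately show "v \<in> M.span (?\<delta> ` {..<l})"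
      using M.finite_span[OF _ carrier] by blast
  qed
  moreover have "has_pdeg K l (?\<delta> i) (e i)" if "i < l" for i
    using hom that by (simp add: has_pdeg_def d_def)
  ultimately show ?thesis
    unfolding free_with_exponents_def indexed_basis_def using carrier inj by blast
qed

end

section \<open>Reduction modulo a prime\<close>

definition of_int_poly :: "(nat multiset \<Rightarrow>\<^sub>0 int) \<Rightarrow> nat multiset \<Rightarrow>\<^sub>0 rat" where
  "of_int_poly = Poly_Mapping.map of_int"

lemma lookup_of_int_poly [simp]: "lookup (of_int_poly f) m = of_int (lookup f m)"
  by (simp add: of_int_poly_def Poly_Mapping.map.rep_eq when_def)

interpretation of_int_poly: comm_ring_hom of_int_poly
proof
  show "of_int_poly (f * g) = of_int_poly f * of_int_poly g" for f g
    by (rule poly_mapping_eqI) (simp add: lookup_mult_submsets)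
  show "of_int_poly 1 = 1"
    by (rule poly_mapping_eqI) (simp add: lookup_one when_def)
qed (auto intro!: poly_mapping_eqI simp: lookup_add)

lemma of_int_poly_single [simp]: "of_int_poly (single m c) = single m (of_int c)"
  by (rule poly_mapping_eqI) (simp add: lookup_single when_def)

lemma of_int_poly_of_int [simp]: "of_int_poly (of_int c) = of_int c"
  using of_int_poly_single[of "{#}" c] by (simp flip: single_of_int)

lemma lookup_of_int_times:
  fixes f :: "'x multiset \<Rightarrow>\<^sub>0 'r::comm_ring_1"
  shows "lookup (of_int c * f) m = of_int c * lookup f m"
  using lookup_single_add_times[of "{#}" "of_int c" f m] by simp

lemma single_int: "single {#} (c::int) = of_int c"
  by (rule trans[OF _ single_of_int]) (simp del: single_of_int)

lemma of_int_mult_single: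
  fixes c :: "'r::comm_ring_1"
  shows "of_int k * single (m :: 'x multiset) c = single m (of_int k * c)"
  by (rule poly_mapping_eqI) (simp add: lookup_of_int_times lookup_single when_def)

lemma of_int_poly_linear_poly: "of_int_poly (linear_poly l b) = linear_poly l (\<lambda>i. of_int (b i))"
  by (simp add: linear_poly_def of_int_poly.hom_sum)

section \<open>Clearing denominators\<close>

lemma clear_denominator:
  "\<exists>s g. s \<noteq> 0 \<and> of_int_poly g = of_int s * f"
proof (induction f rule: poly_mapping_induct_ring)
  case (const c)
  obtain x y where "c = of_int x / of_int y" "y \<noteq> 0"
    by (metis Fract_of_int_quotient Rat_cases less_numeral_extra(3))
  then show ?case
    by (intro exI[of _ y] exI[of _ "of_int x"]) (simp add: of_int_mult_single)
next
  case (var i)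
  show ?case
    by (intro exI[of _ 1] exI[of _ "single {#i#} 1"]) simp
next
  case (add f g)
  then obtain s f' t g' where "s \<noteq> 0" "t \<noteq> 0"
    and "of_int_poly f' = of_int s * f" "of_int_poly g' = of_int t * g"
    by blast
  then show ?case
    by (intro exI[of _ "s * t"] exI[of _ "of_int t * f' + of_int s * g'"])
      (simp add: algebra_simps of_int_poly.hom_add of_int_poly.hom_mult)
next
  case (mult f g)
  then obtain s f' t g' where "s \<noteq> 0" "t \<noteq> 0"
    and "of_int_poly f' = of_int s * f" "of_int_poly g' = of_int t * g"
    by blast
  then show ?case
    by (intro exI[of _ "s * t"] exI[of _ "f' * g'"]) (simp add: algebra_simps of_int_poly.hom_mult)
qed

text \<open>A single denominator for the whole family makes the integral matrix a scalar multiple of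
  the rational one, so its determinant changes by a known power.\<close>

lemma common_denominator:
  assumes "finite I"
  shows "\<exists>s g. s \<noteq> 0 \<and> (\<forall>i\<in>I. of_int_poly (g i) = of_int s * f i)"
  using assms
proof (induction I rule: finite_induct)
  case empty
  show ?case by (intro exI[of _ 1]) simp
next
  case (insert i I)
  then obtain s g where s: "s \<noteq> 0" and g: "\<forall>i\<in>I. of_int_poly (g i) = of_int s * f i"
    by blast
  obtain t g' where t: "t \<noteq> 0" and g': "of_int_poly g' = of_int t * f i"
    using clear_denominator by blast
  have "\<forall>j\<in>insert i I. of_int_poly (if j = i then of_int s * g' else of_int t * g j)
      = of_int (s * t) * f j"
    using g g' by (auto simp: of_int_poly.hom_mult mult_ac)
  with s t show ?case
    by (intro exI[of _ "s * t"] exI[of _ "\<lambda>j. if j = i then of_int s * g' else of_int t * g j"]) simp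
qed

section \<open>The three coefficient rings and the maps between them\<close>

lemma coeff_cover_int: "coeff_cover \<Z> (\<lambda>x. x)"
  by unfold_locales auto

lemma field_rat: "field rat_field"
  by (rule field_from_type_algebra)

lemma coeff_cover_rat: "coeff_cover rat_field (\<lambda>x. x)"
proof -
  interpret field rat_field by (rule field_rat)
  show ?thesis
    by unfold_locales (auto simp: ring_of_type_algebra_def)
qed

lemma field_prime_field:
  assumes "Factorial_Ring.prime p"
  shows "field (prime_field p)"
proof -
  interpret residues_prime p "prime_field p"
    by unfold_locales (use assms in auto)
  show ?thesis by (rule is_field)
qed

lemma coeff_cover_prime_field:
  assumes "Factorial_Ring.prime p"
  shows "coeff_cover (prime_field p) (\<lambda>x. x mod int p)"
proof -
  interpret field "prime_field p" by (rule field_prime_field[OF assms])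
  have p: "int p > 1"
    using prime_gt_1_nat[OF assms] by simp
  show ?thesis
  proof unfold_locales
    show "carrier (prime_field p) \<subseteq> range (\<lambda>x. x mod int p)"
    proof
      fix x assume "x \<in> carrier (prime_field p)"
      then have "x = x mod int p"
        by (auto simp: residue_ring_def)
      then show "x \<in> range (\<lambda>x. x mod int p)"
        by (rule range_eqI)
    qed
  qed (use p in \<open>auto simp: residue_ring_def mod_add_eq mod_mult_eq\<close>)
qed

abbreviation int_map where "int_map \<equiv> coeff_map \<Z> (\<lambda>x. x)"
abbreviation rat_map where "rat_map \<equiv> coeff_map rat_field (\<lambda>x. x)"
abbreviation prime_map where "prime_map p \<equiv> coeff_map (prime_field p) (\<lambda>x. x mod int p)"

lemma rat_map_of_int_poly: "rat_map l (of_int_poly f) = int_to_rat (int_map l f)"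
  by (auto simp: coeff_map_def int_to_rat_def ring_of_type_algebra_def)

lemma prime_map_eq: "prime_map p l f = reduce_mod p (int_map l f)"
  by (auto simp: coeff_map_def reduce_mod_def residue_ring_def)

text \<open>The integers embed into the rationals coefficientwise, so a rational identity between
  integral representatives holds over \<open>\<Z>\<close>.\<close>

lemma int_map_eqI:
  assumes "rat_map l (of_int_poly f) = rat_map l (of_int_poly g)"
  shows "int_map l f = int_map l g"
  using assms by (auto simp: rat_map_of_int_poly int_to_rat_def fun_eq_iff)

text \<open>Reduction factors through \<open>int_map\<close>, so an identity over
  \<open>\<Z>\<close> holds modulo every \<open>p\<close>.\<close>

lemma prime_map_cong: "int_map l f = int_map l g \<Longrightarrow> prime_map p l f = prime_map p l g"
  by (simp add: prime_map_eq)

section \<open>Good primes and freeness over the prime field\<close>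

text \<open>If one reduced form divided another, its square would divide the reduced defining
  polynomial. Square-freeness would then make a linear form a unit.\<close>

lemma good_prime_not_hdvd:
  assumes good: "good_prime l n \<alpha> p" and \<alpha>: "\<And>k. k < n \<Longrightarrow> \<alpha> k = int_map l (linear_poly l (a k))"
    and k: "k < n" "k' < n" "k \<noteq> k'"
  shows "\<not> domain_hom.hdvd (prime_map p l) (linear_poly l (a k)) (linear_poly l (a k'))"
proof
  interpret Z: coeff_cover \<Z> "\<lambda>x. x" l by (rule coeff_cover_int)
  interpret F: coeff_cover "prime_field p" "\<lambda>x. x mod int p" l
    using good by (intro coeff_cover_prime_field) (simp add: good_prime_def)
  let ?L = "\<lambda>k. linear_poly l (a k)"
  assume "F.poly.hdvd (?L k) (?L k')"
  then obtain q where q: "F.T (?L k') = F.T (?L k * q)"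
    unfolding F.poly.hdvd_def by blast
  let ?R = "prod ?L ({..<n} - {k} - {k'})"
  have "prod ?L {..<n} = ?L k * (?L k' * ?R)"
    using k by (simp add: prod.remove[of "{..<n}" k] prod.remove[of "{..<n} - {k}" k'])
  then have "F.T (prod ?L {..<n}) = F.T (?L k * (?L k * q * ?R))"
    using q by (simp add: F.T_mult[of "?L k"] F.T_mult[of "?L k'"] F.T_mult[of "?L k * q"])
  also have "\<dots> = F.T (?L k) \<otimes>\<^bsub>F.P\<^esub> F.T (?L k) \<otimes>\<^bsub>F.P\<^esub> F.T (q * ?R)"
    by (simp only: F.T_mult[symmetric] mult.assoc)
  finally have prod: "F.T (prod ?L {..<n})
      = F.T (?L k) \<otimes>\<^bsub>F.P\<^esub> F.T (?L k) \<otimes>\<^bsub>F.P\<^esub> F.T (q * ?R)" .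
  have "defining_poly l n \<alpha> = Z.T (prod ?L {..<n})"
    unfolding defining_poly_def Z.poly.H_prod[OF finite_lessThan]
    by (rule Z.poly.finprod_cong') (auto simp: \<alpha> Z.T_closed)
  then have "(F.T (?L k) \<otimes>\<^bsub>F.P\<^esub> F.T (?L k)) divides\<^bsub>F.P\<^esub> reduce_mod p (defining_poly l n \<alpha>)"
    using prod F.T_closed by (auto simp: prime_map_eq[symmetric] factor_def)
  then have "F.T (?L k) \<in> Units F.P"
    using good F.T_closed by (auto simp: good_prime_def square_free_def)
  then obtain y where "y \<in> carrier F.P" "F.T (?L k) \<otimes>\<^bsub>F.P\<^esub> y = \<one>\<^bsub>F.P\<^esub>"
    by (auto simp: Units_def)
  then obtain f where "F.T (?L k) \<otimes>\<^bsub>F.P\<^esub> F.T f = \<one>\<^bsub>F.P\<^esub>"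
    by (auto simp: F.carrier_P)
  then have "F.T 1 = F.T (?L k * f)"
    by (simp only: F.T_mult F.T_one)
  then show False
    using F.linear_poly_nonunit F.poly.hdvdI by blast
qed

text \<open>The hypotheses are the data of Saito's criterion after clearing denominators. The
  integers \<open>t\<close>, \<open>s\<close>, \<open>w\<close>, \<open>r\<close> are what separates
  them from the criterion itself, and modulo \<open>p\<close> they can be inverted.\<close>

lemma prime_field_free:
  assumes p: "Factorial_Ring.prime p"
    and lin: "linear_arrangement (prime_field p) (\<lambda>x. x mod int p) l n a"
    and D: "D \<in> carrier_mat l l"
    and det: "int_map l (of_int t * det D)
      = int_map l (of_int s ^ l * c * (\<Prod>k<n. linear_poly l (a k)))"
    and unit: "int_map l (c * c') = int_map l (of_int w)"
    and rows: "\<And>i k. i < l \<Longrightarrow> k < n \<Longrightarrow>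
      int_map l (of_int r * (\<Sum>j<l. D $$ (i,j) * single {#} (a k j)))
        = int_map l (linear_poly l (a k) * q i k)"
    and hom: "\<And>i j. i < l \<Longrightarrow> j < l \<Longrightarrow> homogeneous \<Z> (e i) (int_map l (D $$ (i,j)))"
    and nz: "\<not> int p dvd t" "\<not> int p dvd s" "\<not> int p dvd w" "\<not> int p dvd r"
  shows "free_with_exponents (prime_field p) l
    ((\<lambda>k. zero_locus (prime_field p) l (prime_map p l (linear_poly l (a k)))) ` {..<n}) e"
proof -
  interpret F: linear_arrangement "prime_field p" "\<lambda>x. x mod int p" l n a by (rule lin)
  have inverse: "\<exists>u. F.T (of_int u * of_int x) = \<one>\<^bsub>F.P\<^esub>" if "\<not> int p dvd x" for x
  proof -
    have "x mod int p \<noteq> \<zero>\<^bsub>prime_field p\<^esub>"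
      using that by (auto simp: residue_ring_def)
    then obtain u where "x * u mod int p = \<one>\<^bsub>prime_field p\<^esub>"
      using F.exists_inverse by blast
    then have "F.T (single {#} (x * u)) = \<one>\<^bsub>F.P\<^esub>"
      by (simp only: F.coeff_map_const) (simp add: mpoly_ring_def)
    also have "single {#} (x * u) = of_int u * of_int x"
      by (simp add: single_int mult.commute)
    finally have "F.T (of_int u * of_int x) = \<one>\<^bsub>F.P\<^esub>" .
    then show ?thesis by blast
  qed
  obtain t' s' w' r' where t': "F.T (of_int t' * of_int t) = \<one>\<^bsub>F.P\<^esub>"
    and s': "F.T (of_int s' * of_int s) = \<one>\<^bsub>F.P\<^esub>"
    and w': "F.T (of_int w' * of_int w) = \<one>\<^bsub>F.P\<^esub>"
    and r': "F.T (of_int r' * of_int r) = \<one>\<^bsub>F.P\<^esub>"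
    using inverse nz by meson
  \<comment> \<open>The quotient of \<open>det D\<close> by the product of the forms is
    \<open>c\<close> times \<open>s ^ l\<close> over \<open>t\<close>. In its inverse
    \<open>?c'\<close>, the factor \<open>w'\<close> corrects \<open>c * c'\<close>, which is
    \<open>w\<close> rather than one.\<close>
  let ?c = "of_int t' * (of_int s ^ l * c)"
  let ?c' = "of_int w' * (of_int s' ^ l * (of_int t * c'))"
  show ?thesis
  proof (rule F.det_imp_free)
    show "F.log_rows D"
      unfolding F.log_rows_def F.logarithmic_def
    proof (intro conjI allI impI)
      fix i k assume "i < l" "k < n"
      then have "F.T (\<Sum>j<l. D $$ (i,j) * single {#} (a k j))
          = F.T (of_int r' * (linear_poly l (a k) * q i k))"
        by (intro F.poly.H_unit_cancel[OF r'] prime_map_cong rows)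
      then show "F.poly.hdvd (linear_poly l (a k)) (\<Sum>j<l. D $$ (i,j) * single {#} (a k j))"
        by (intro F.poly.hdvdI[of _ _ "of_int r' * q i k"]) (simp add: mult.left_commute)
    qed (rule D)
    have "F.T (det D) = F.T (of_int t' * (of_int s ^ l * c * (\<Prod>k<n. linear_poly l (a k))))"
      by (rule F.poly.H_unit_cancel[OF t' prime_map_cong[OF det]])
    then show "F.T (det D) = F.T (?c * (\<Prod>k<n. linear_poly l (a k)))"
      by (simp only: mult.assoc)
    have "?c * ?c' = (of_int t' * of_int t) * (of_int s' * of_int s) ^ l
        * (of_int w' * (c * c'))"
      by (simp only: power_mult_distrib mult_ac)
    then have "F.T (?c * ?c') = F.T (of_int t' * of_int t)
        \<otimes>\<^bsub>F.P\<^esub> F.T ((of_int s' * of_int s) ^ l) \<otimes>\<^bsub>F.P\<^esub> F.T (of_int w' * (c * c'))"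
      by (simp only: F.T_mult)
    also have "F.T (of_int w' * (c * c')) = F.T (of_int w' * of_int w)"
      using prime_map_cong[OF unit, of p] by (simp only: F.T_mult[of "of_int w'"])
    finally show "F.T (?c * ?c') = \<one>\<^bsub>F.P\<^esub>"
      by (simp only: t' w' F.poly.H_power_one[OF s'] F.poly.l_one F.poly.one_closed)
    \<comment> \<open>A coefficient that survives reduction was nonzero before, so no new degree
      appears.\<close>
    show "homogeneous (prime_field p) (e i) (F.T (D $$ (i,j)))" if "i < l" "j < l" for i j
      unfolding homogeneous_def
    proof (intro allI impI)
      have zero: "\<zero>\<^bsub>prime_field p\<^esub> = 0"
        by (simp add: residue_ring_def)
      fix x assume "F.T (D $$ (i,j)) x \<noteq> \<zero>\<^bsub>prime_field p\<^esub>"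
      then have "int_map l (D $$ (i,j)) x \<noteq> 0"
        unfolding zero by (auto simp: prime_map_eq reduce_mod_def)
      then show "size x = e i"
        using hom[OF that] by (simp add: homogeneous_def)
    qed
  qed
qed

lemma finite_prime_divisors:
  assumes "N \<noteq> (0::int)"
  shows "finite {p. Factorial_Ring.prime p \<and> int p dvd N}"
proof (rule finite_subset)
  show "{p. Factorial_Ring.prime p \<and> int p dvd N} \<subseteq> {..nat \<bar>N\<bar>}"
    using assms by (auto dest!: dvd_imp_le_int)
qed simp

theorem theorem4p3:
  fixes l n :: nat
    and A :: "(nat \<Rightarrow> rat) set set"
    and H :: "nat \<Rightarrow> (nat \<Rightarrow> rat) set"
    and \<alpha> :: "nat \<Rightarrow> nat multiset \<Rightarrow> int"
    and e :: "nat \<Rightarrow> nat"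
  assumes "central_arrangement rat_field l A"
    and "bij_betw H {..<n} A"
    and "\<And>i. i < n \<Longrightarrow> linear_form \<Z> l (\<alpha> i)"
    and "\<And>i. i < n \<Longrightarrow> primitive l (\<alpha> i)"
    and "\<And>i. i < n \<Longrightarrow> H i = zero_locus rat_field l (int_to_rat (\<alpha> i))"
    and "free_with_exponents rat_field l A e"
  shows "finite {p. good_prime l n \<alpha> p \<and>
    \<not> free_with_exponents (prime_field p) l (reduced_arrangement l n \<alpha> p) e}"
proof -
  interpret Z: coeff_cover \<Z> "\<lambda>x. x" l by (rule coeff_cover_int)
  have "\<forall>k\<in>{..<n}. \<exists>b. \<alpha> k = Z.T (linear_poly l b) \<and> (\<exists>j<l. b j \<noteq> 0)"
    using assms(3) Z.linear_form_imp_linear_poly by (metis lessThan_iff ring.simps(1))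
  then obtain a where \<alpha>: "\<And>k. k < n \<Longrightarrow> \<alpha> k = Z.T (linear_poly l (a k))"
    and "\<And>k. k < n \<Longrightarrow> \<exists>j<l. a k j \<noteq> 0"
    by (metis lessThan_iff)
  \<comment> \<open>A prime that does not divide \<open>a k (s k)\<close> keeps the
    \<open>k\<close>-th form nonzero.\<close>
  then obtain s where s: "\<And>k. k < n \<Longrightarrow> s k < l" "\<And>k. k < n \<Longrightarrow> a k (s k) \<noteq> 0"
    by metis
  define b where "b k j = (of_int (a k j) :: rat)" for k j
  let ?LZ = "\<lambda>k. linear_poly l (a k)"
  let ?LQ = "\<lambda>k. linear_poly l (b k)"
  have LQ: "of_int_poly (?LZ k) = ?LQ k" for k
    by (simp add: of_int_poly_linear_poly b_def[abs_def])
  have H: "H k = zero_locus rat_field l (rat_map l (?LQ k))" if "k < n" for k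
    using that assms(5) \<alpha> by (simp add: rat_map_of_int_poly flip: LQ)

  interpret Q0: coeff_cover rat_field "\<lambda>x. x" l by (rule coeff_cover_rat)
  interpret Q: linear_arrangement rat_field "\<lambda>x. x" l n b
  proof (intro linear_arrangement.intro coeff_cover_rat field_rat, unfold_locales)
    fix k assume "k < n"
    then show "\<exists>j<l. b k j \<noteq> \<zero>\<^bsub>rat_field\<^esub>"
      using s by (intro exI[of _ "s k"]) (simp add: b_def ring_of_type_algebra_def)
  next
    fix k k' assume k: "k < n" "k' < n" "k \<noteq> k'"
    show "\<not> Q0.poly.hdvd (?LQ k) (?LQ k')"
    proof
      assume "Q0.poly.hdvd (?LQ k) (?LQ k')"
      then obtain c where c: "\<And>i. i < l \<Longrightarrow> b k' i = c * b k i"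
        using Q0.linear_poly_hdvd_linear_poly by blast
      \<comment> \<open>A nonzero coefficient makes the factor \<open>c\<close> invertible, so the
        two zero loci contain each other, against the injectivity of \<open>H\<close>.\<close>
      have "b k' (s k') \<noteq> 0"
        using s k by (simp add: b_def)
      then have "c \<noteq> 0"
        using c[of "s k'"] s k by auto
      have "H k \<subseteq> H k'"
        unfolding H[OF k(1)] H[OF k(2)]
        by (rule Q0.zero_locus_subset[of c]) (auto simp: c ring_of_type_algebra_def)
      moreover have "H k' \<subseteq> H k"
        unfolding H[OF k(1)] H[OF k(2)]
        by (rule Q0.zero_locus_subset[of "1 / c"])
          (use \<open>c \<noteq> 0\<close> in \<open>auto simp: c ring_of_type_algebra_def\<close>)
      ultimately show False
        using assms(2) k by (auto simp: bij_betw_def inj_on_def)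
    qed
  qed

  have "A = H ` {..<n}"
    using assms(2) by (simp add: bij_betw_def)
  also have "\<dots> = Q.arrangement"
    by (intro image_cong) (auto simp: H)
  finally have "free_with_exponents rat_field l Q.arrangement e"
    using assms(6) by simp
  then obtain M c c' where M: "Q.log_rows M" and det: "Q0.T (det M) = Q0.T (c * Q.Q)"
    and unit: "Q0.T (c * c') = \<one>\<^bsub>Q0.P\<^esub>"
    and hom: "\<And>i j. i < l \<Longrightarrow> j < l \<Longrightarrow> homogeneous rat_field (e i) (Q0.T (M $$ (i,j)))"
    by (rule Q.free_imp_det) (rule that; assumption)
  have Mc: "M \<in> carrier_mat l l"
    using M by (simp add: Q.log_rows_def)
  \<comment> \<open>Choosing the quotients as one indexed family lets a single integer
    \<open>r\<close> clear all their denominators.\<close>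
  define q where
    "q i k = (SOME f. Q0.T (\<Sum>j<l. M $$ (i,j) * single {#} (b k j)) = Q0.T (?LQ k * f))" for i k
  have q: "Q0.T (\<Sum>j<l. M $$ (i,j) * single {#} (b k j)) = Q0.T (?LQ k * q i k)"
    if "i < l" "k < n" for i k
  proof -
    have "\<exists>f. Q0.T (\<Sum>j<l. M $$ (i,j) * single {#} (b k j)) = Q0.T (?LQ k * f)"
      using M that unfolding Q.log_rows_def Q.logarithmic_def Q0.poly.hdvd_def by blast
    then show ?thesis
      unfolding q_def by (rule someI_ex)
  qed

  obtain m D where m: "m \<noteq> 0" and D: "\<And>i j. i < l \<Longrightarrow> j < l \<Longrightarrow>
      of_int_poly (D (i,j)) = of_int m * M $$ (i,j)"
    using common_denominator[of "{..<l} \<times> {..<l}" "\<lambda>x. M $$ x"] by auto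
  obtain r g where r: "r \<noteq> 0" and g: "\<And>i k. i < l \<Longrightarrow> k < n \<Longrightarrow>
      of_int_poly (g (i,k)) = of_int r * q i k"
    using common_denominator[of "{..<l} \<times> {..<n}" "\<lambda>x. q (fst x) (snd x)"] by auto
  obtain t d where t: "t \<noteq> 0" and d: "of_int_poly d = of_int t * c"
    using clear_denominator by blast
  obtain t' d' where t': "t' \<noteq> 0" and d': "of_int_poly d' = of_int t' * c'"
    using clear_denominator by blast
  define N where "N = mat l l D"
  note of_int_hom = of_int_poly.hom_mult of_int_poly.hom_power of_int_poly.hom_sum of_int_poly.hom_prod
  \<comment> \<open>Each of the \<open>l\<close> rows is scaled by \<open>m\<close>, which is the
    origin of the factor \<open>m ^ l\<close>.\<close>
  have "map_mat of_int_poly N = of_int m \<cdot>\<^sub>m M"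
    by (rule eq_matI) (use Mc D in \<open>auto simp: N_def\<close>)
  then have "of_int_poly (det N) = of_int m ^ l * det M"
    using Mc by (metis of_int_poly.hom_det det_smult carrier_matD(2))
  then have N_poly: "of_int_poly (of_int t * det N) = of_int t * of_int m ^ l * det M"
    by (simp add: of_int_hom mult.assoc)
  have Q_poly: "of_int_poly (of_int m ^ l * d * (\<Prod>k<n. ?LZ k)) = of_int t * of_int m ^ l * (c * Q.Q)"
    by (simp add: of_int_hom d LQ mult_ac)
  have N_det: "int_map l (of_int t * det N)
      = int_map l (of_int m ^ l * d * (\<Prod>k<n. ?LZ k))"
    by (rule int_map_eqI) (simp only: N_poly Q_poly Q0.T_mult[of "of_int t * of_int m ^ l"] det)
  \<comment> \<open>The unit and its inverse were cleared separately, so their product is the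
    integer \<open>t * t'\<close> instead of one.\<close>
  have N_unit: "int_map l (d * d') = int_map l (of_int (t * t'))"
  proof (rule int_map_eqI)
    have "of_int_poly (d * d') = of_int (t * t') * (c * c')"
      by (simp add: of_int_hom d d' mult_ac)
    then have "Q0.T (of_int_poly (d * d')) = Q0.T (of_int (t * t')) \<otimes>\<^bsub>Q0.P\<^esub> Q0.T 1"
      by (simp only: Q0.T_mult[of "of_int (t * t')"] unit Q0.T_one)
    then show "Q0.T (of_int_poly (d * d')) = Q0.T (of_int_poly (of_int (t * t')))"
      by (simp only: Q0.T_mult[symmetric] mult_1_right of_int_poly_of_int)
  qed
  \<comment> \<open>The row already carries \<open>m\<close> and the quotient \<open>g (i,k)\<close>
    carries \<open>r\<close>; each side is completed by the factor it is missing.\<close>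
  have N_rows: "int_map l (of_int r * (\<Sum>j<l. N $$ (i,j) * single {#} (a k j)))
      = int_map l (?LZ k * (of_int m * g (i,k)))" if "i < l" "k < n" for i k
  proof (rule int_map_eqI)
    have "of_int_poly (\<Sum>j<l. N $$ (i,j) * single {#} (a k j))
        = of_int m * (\<Sum>j<l. M $$ (i,j) * single {#} (b k j))"
      unfolding of_int_poly.hom_sum sum_distrib_left mult.assoc[symmetric]
      by (rule sum.cong) (use that D in \<open>auto simp: N_def of_int_hom b_def simp del: single_of_int\<close>)
    then have lhs: "of_int_poly (of_int r * (\<Sum>j<l. N $$ (i,j) * single {#} (a k j)))
        = of_int r * of_int m * (\<Sum>j<l. M $$ (i,j) * single {#} (b k j))"
      by (simp only: of_int_poly.hom_mult of_int_poly_of_int mult.assoc)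
    have rhs: "of_int_poly (?LZ k * (of_int m * g (i,k))) = of_int r * of_int m * (?LQ k * q i k)"
      using that by (simp add: of_int_hom LQ g mult_ac)
    show "Q0.T (of_int_poly (of_int r * (\<Sum>j<l. N $$ (i,j) * single {#} (a k j))))
        = Q0.T (of_int_poly (?LZ k * (of_int m * g (i,k))))"
      unfolding lhs rhs Q0.T_mult[of "of_int r * of_int m"] q[OF that] ..
  qed
  have N_hom: "homogeneous \<Z> (e i) (int_map l (N $$ (i,j)))" if "i < l" "j < l" for i j
    unfolding homogeneous_def
  proof (intro allI impI)
    fix x assume "int_map l (N $$ (i,j)) x \<noteq> \<zero>\<^bsub>\<Z>\<^esub>"
    then have x: "set_mset x \<subseteq> {..<l}" and "lookup (D (i,j)) x \<noteq> 0"
      using that by (auto simp: coeff_map_def N_def split: if_splits)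
    then have "lookup (of_int_poly (D (i,j))) x \<noteq> 0"
      by simp
    then have "lookup (M $$ (i,j)) x \<noteq> 0"
      unfolding D[OF that] lookup_of_int_times by simp
    then have "Q0.T (M $$ (i,j)) x \<noteq> \<zero>\<^bsub>rat_field\<^esub>"
      using x by (simp add: coeff_map_def ring_of_type_algebra_def)
    then show "size x = e i"
      using hom[OF that] by (simp add: homogeneous_def)
  qed

  \<comment> \<open>The product collects all denominators and one nonzero coefficient of each form.
    It is a nonzero integer, so every exceptional prime is among its finitely many prime
    divisors.\<close>
  have "free_with_exponents (prime_field p) l (reduced_arrangement l n \<alpha> p) e"
    if good: "good_prime l n \<alpha> p" and ndvd: "\<not> int p dvd m * r * t * t' * (\<Prod>k<n. a k (s k))" for p
  proof -
    have p: "Factorial_Ring.prime p"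
      using good by (simp add: good_prime_def)
    have "linear_arrangement (prime_field p) (\<lambda>x. x mod int p) l n a"
    proof (intro linear_arrangement.intro coeff_cover_prime_field field_prime_field p, unfold_locales)
      fix k assume k: "k < n"
      then have "a k (s k) dvd (\<Prod>k<n. a k (s k))"
        by (intro dvd_prodI) auto
      then have "\<not> int p dvd a k (s k)"
        using ndvd by (meson dvd_mult dvd_trans)
      then show "\<exists>j<l. a k j mod int p \<noteq> \<zero>\<^bsub>prime_field p\<^esub>"
        using s k by (auto simp: residue_ring_def)
    qed (rule good_prime_not_hdvd[OF good \<alpha>])
    moreover have "\<not> int p dvd t" "\<not> int p dvd m" "\<not> int p dvd t * t'" "\<not> int p dvd r"
      using ndvd p by (auto simp: prime_dvd_mult_iff)
    ultimately have "free_with_exponents (prime_field p) l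
        ((\<lambda>k. zero_locus (prime_field p) l (prime_map p l (?LZ k))) ` {..<n}) e"
      using N_det N_unit N_rows N_hom p
      by (intro prime_field_free[of p l n a N t m d d' "t * t'" r]) (auto simp: N_def)
    moreover have "reduced_arrangement l n \<alpha> p
        = (\<lambda>k. zero_locus (prime_field p) l (prime_map p l (?LZ k))) ` {..<n}"
      unfolding reduced_arrangement_def by (intro image_cong) (auto simp: prime_map_eq \<alpha>)
    ultimately show ?thesis by simp
  qed
  then have "{p. good_prime l n \<alpha> p \<and> \<not> free_with_exponents (prime_field p) l (reduced_arrangement l n \<alpha> p) e}
      \<subseteq> {p. Factorial_Ring.prime p \<and> int p dvd m * r * t * t' * (\<Prod>k<n. a k (s k))}"
    by (auto simp: good_prime_def)
  moreover have "m * r * t * t' * (\<Prod>k<n. a k (s k)) \<noteq> 0"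
    using m r t t' s by simp
  ultimately show ?thesis
    using finite_prime_divisors finite_subset by blast
qed

end
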